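(* Let $\mu^1,\dots,\mu^J\in\mathcal{M}_+(\mathcal{X})$ with positive total masses, $\mathcal{X}_i=\mathrm{supp}(\mu^i)$, and let $\hat\mu^i=\hat\mu^i_{N_i}$ be multinomial-model estimators with sample sizes $N_1,\dots,N_J$. Then for any minimiser $\mu^\star$ of $F_{p,C}$ and any minimiser $\hat\mu^\star$ of $\hat F_{p,C}$ (over finitely supported non-negative measures on $\mathcal{Y}$), for $p\ge1$, $C>0$, $$\mathbb{E}\big[|F_{p,C}(\mu^\star)-F_{p,C}(\hat\mu^\star)|\big]\le\frac{2p\min\{\mathrm{diam}(\mathcal{Y}),C\}^{p-1}}{J}\sum_{i=1}^J\mathcal{E}^{\mathrm{Mult}}_{1,\mathcal{X}_i,\mu^i}(C)N_i^{-1/2}.$$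
   Context: $(\mathcal{Y},d)$ connected metric space, $\mathcal{X}\subset\mathcal{Y}$ finite. For finitely supported non-negative measures on $\mathcal{Y}$: $\mathrm{KR}_{p,C}(\mu,\nu)^p=\min_\pi\sum d^p(x,x')\pi(x,x')+C^p(\frac{\mathbb{M}(\mu)+\mathbb{M}(\nu)}2-\mathbb{M}(\pi))$ over non-negative $\pi$ with row sums $\le\mu$ and column sums $\le\nu$; $\mathbb{M}$ total mass. $F_{p,C}(\mu)=\frac1J\sum_i\mathrm{KR}^p_{p,C}(\mu^i,\mu)$, $\hat F_{p,C}(\mu)=\frac1J\sum_i\mathrm{KR}^p_{p,C}(\hat\mu^i,\mu)$. Multinomial model: $X_1,\dots,X_N$ i.i.d. $\sim\mu^i/\mathbb{M}(\mu^i)$, $\hat\mu^i_N=\frac{\mathbb{M}(\mu^i)}N\sum_x|\{k:X_k=x\}|\delta_x$. For a finite metric space $\mathcal{Z}$ and $\rho\in\mathcal{M}_+(\mathcal{Z})$: $h^{\mathcal{Z}}_{q,L}(k)=\frac{q^{1-k}-q^{-L}}{q-1}\mathrm{diam}(\mathcal{Z})$; $Q^{\mathcal{Z}}_j$ minimal-cardinality $q^{-j}\mathrm{diam}(\mathcal{Z})$-cover by points of $\mathcal{Z}$; $A_{q,L,\mathcal{Z}}(l)=\mathrm{diam}(\mathcal{Z})(q^{-L}|\mathcal{Z}|^{1/2}+\frac q{q-1}\sum_{j=l}^Lq^{1-j}|Q^{\mathcal{Z}}_j|^{1/2})$; $m_{\mathcal{Z}}=\min_{x\ne x'\in\mathcal{Z}}d(x,x')$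 ($+\infty$ if $|\mathcal{Z}|=1$); $\mathcal{E}^{\mathrm{Mult}}_{1,\mathcal{Z},\rho}(C,q,L)=\frac C2\sqrt{\mathbb{M}(\rho)}\sum_x\sqrt{\rho(x)}$ if $C\le\max\{2h^{\mathcal{Z}}_{q,L}(L),m_{\mathcal{Z}}\}$, else $\mathbb{M}(\rho)A_{q,L,\mathcal{Z}}(1)$ if $C\ge2h^{\mathcal{Z}}_{q,L}(0)$, else $\mathbb{M}(\rho)A_{q,L,\mathcal{Z}}(l)$ with $2h^{\mathcal{Z}}_{q,L}(l)\le C<2h^{\mathcal{Z}}_{q,L}(l-1)$; and $\mathcal{E}^{\mathrm{Mult}}_{1,\mathcal{Z},\rho}(C)=\inf_{q>1,L\in\mathbb{N}}\mathcal{E}^{\mathrm{Mult}}_{1,\mathcal{Z},\rho}(C,q,L)$. *)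

theory Defs
  imports "HOL-Analysis.Analysis" "HOL-Probability.Probability"
begin

text \<open>Finitely supported non-negative measures are represented as functions
  'a => real; the support is the set of points with non-zero weight.\<close>

definition supp :: "('a \<Rightarrow> real) \<Rightarrow> 'a set" where
  "supp \<mu> = {x. \<mu> x \<noteq> 0}"

definition fsmeas :: "'a set \<Rightarrow> ('a \<Rightarrow> real) \<Rightarrow> bool" where
  "fsmeas Y \<mu> \<longleftrightarrow> (\<forall>x. 0 \<le> \<mu> x) \<and> finite (supp \<mu>) \<and> supp \<mu> \<subseteq> Y"

definition mass :: "('a \<Rightarrow> real) \<Rightarrow> real" where
  "mass \<mu> = (\<Sum>x\<in>supp \<mu>. \<mu> x)"

definition plans :: "('a \<Rightarrow> real) \<Rightarrow> ('a \<Rightarrow> real) \<Rightarrow> ('a \<times> 'a \<Rightarrow> real) set" where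
  "plans \<mu> \<nu> = {\<pi>. (\<forall>z. 0 \<le> \<pi> z)
      \<and> (\<forall>x x'. (x \<notin> supp \<mu> \<or> x' \<notin> supp \<nu>) \<longrightarrow> \<pi> (x, x') = 0)
      \<and> (\<forall>x. (\<Sum>x'\<in>supp \<nu>. \<pi> (x, x')) \<le> \<mu> x)
      \<and> (\<forall>x'. (\<Sum>x\<in>supp \<mu>. \<pi> (x, x')) \<le> \<nu> x')}"

definition plan_mass :: "('a \<Rightarrow> real) \<Rightarrow> ('a \<Rightarrow> real) \<Rightarrow> ('a \<times> 'a \<Rightarrow> real) \<Rightarrow> real" where
  "plan_mass \<mu> \<nu> \<pi> = (\<Sum>z\<in>supp \<mu> \<times> supp \<nu>. \<pi> z)"

definition KR_pow :: "real \<Rightarrow> real \<Rightarrow> ('a::metric_space \<Rightarrow> real) \<Rightarrow> ('a \<Rightarrow> real) \<Rightarrow> real" where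
  "KR_pow p C \<mu> \<nu> = Inf ((\<lambda>\<pi>. (\<Sum>(x, x')\<in>supp \<mu> \<times> supp \<nu>. dist x x' powr p * \<pi> (x, x'))
        + C powr p * ((mass \<mu> + mass \<nu>) / 2 - plan_mass \<mu> \<nu> \<pi>)) ` plans \<mu> \<nu>)"

definition Fbar :: "real \<Rightarrow> real \<Rightarrow> nat \<Rightarrow> (nat \<Rightarrow> 'a::metric_space \<Rightarrow> real) \<Rightarrow> ('a \<Rightarrow> real) \<Rightarrow> real" where
  "Fbar p C J \<mu>s \<mu> = (1 / real J) * (\<Sum>i<J. KR_pow p C (\<mu>s i) \<mu>)"

definition is_minimiser :: "'a set \<Rightarrow> (('a \<Rightarrow> real) \<Rightarrow> real) \<Rightarrow> ('a \<Rightarrow> real) \<Rightarrow> bool" where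
  "is_minimiser Y F \<mu> \<longleftrightarrow> fsmeas Y \<mu> \<and> (\<forall>\<nu>. fsmeas Y \<nu> \<longrightarrow> F \<mu> \<le> F \<nu>)"

definition normalised_pmf :: "('a \<Rightarrow> real) \<Rightarrow> 'a pmf" where
  "normalised_pmf \<mu> = embed_pmf (\<lambda>x. \<mu> x / mass \<mu>)"

definition emp_est :: "('a \<Rightarrow> real) \<Rightarrow> 'a list \<Rightarrow> 'a \<Rightarrow> real" where
  "emp_est \<mu> xs = (\<lambda>x. mass \<mu> / real (length xs) * real (count_list xs x))"

definition sample_pmf :: "nat \<Rightarrow> (nat \<Rightarrow> 'a \<Rightarrow> real) \<Rightarrow> (nat \<Rightarrow> nat) \<Rightarrow> (nat \<Rightarrow> 'a list) pmf" where
  "sample_pmf J \<mu>s N = Pi_pmf {..<J} [] (\<lambda>i. replicate_pmf (N i) (normalised_pmf (\<mu>s i)))"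

definition hq :: "'a::metric_space set \<Rightarrow> real \<Rightarrow> nat \<Rightarrow> nat \<Rightarrow> real" where
  "hq Z q L k = (q powr (1 - real k) - q powr (- real L)) / (q - 1) * diameter Z"

definition cover_num :: "'a::metric_space set \<Rightarrow> real \<Rightarrow> nat" where
  "cover_num Z r = (LEAST n. \<exists>S\<subseteq>Z. card S = n \<and> (\<forall>z\<in>Z. \<exists>s\<in>S. dist z s \<le> r))"

definition Aq :: "'a::metric_space set \<Rightarrow> real \<Rightarrow> nat \<Rightarrow> nat \<Rightarrow> real" where
  "Aq Z q L l = diameter Z * (q powr (- real L) * sqrt (real (card Z))
     + q / (q - 1) * (\<Sum>j\<in>{l..L}. q powr (1 - real j) * sqrt (real (cover_num Z (q powr (- real j) * diameter Z)))))"

text \<open>Minimal separation m_Z; only used when card Z >= 2 (m_Z = +infinity otherwise).\<close>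
definition min_sep :: "'a::metric_space set \<Rightarrow> real" where
  "min_sep Z = Min {dist x x' | x x'. x \<in> Z \<and> x' \<in> Z \<and> x \<noteq> x'}"

definition EMult_qL :: "'a::metric_space set \<Rightarrow> ('a \<Rightarrow> real) \<Rightarrow> real \<Rightarrow> real \<Rightarrow> nat \<Rightarrow> real" where
  "EMult_qL Z \<rho> C q L =
    (if card Z \<le> 1 \<or> C \<le> max (2 * hq Z q L L) (min_sep Z)
     then C / 2 * sqrt (mass \<rho>) * (\<Sum>x\<in>Z. sqrt (\<rho> x))
     else if 2 * hq Z q L 0 \<le> C then mass \<rho> * Aq Z q L 1
     else mass \<rho> * Aq Z q L (SOME l. l \<in> {1..L} \<and> 2 * hq Z q L l \<le> C \<and> C < 2 * hq Z q L (l - 1)))"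

definition EMult :: "'a::metric_space set \<Rightarrow> ('a \<Rightarrow> real) \<Rightarrow> real \<Rightarrow> real" where
  "EMult Z \<rho> C = Inf {EMult_qL Z \<rho> C q L | q L. q > 1 \<and> L \<ge> 1}"

text \<open>min{diam(Y), C}, where diam(Y) = +infinity for unbounded Y.\<close>
definition min_diam :: "'a::metric_space set \<Rightarrow> real \<Rightarrow> real" where
  "min_diam Y C = (if bounded Y then min (diameter Y) C else C)"

end

theory Submission
  imports Defs
begin

text \<open>By optimality of both minimisers, the gap in the objective is at most the sum of the deviations
  of the empirical objective from the true one at the two minimisers. For a fixed second argument,
  \<open>KR_pow\<close> changes by at most \<open>p * min {diam Y, C} ^ (p - 1)\<close> times the cost, for the metric truncated
  at \<open>C\<close>, of any coupling along which the first argument is moved, because \<open>t ^ p\<close> has this Lipschitz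
  constant. This is used only for couplings moving the excess mass of \<open>\<mu>\<close> over its estimator, and
  conversely, up a tree of nested covers of the support: the price is the edge length times the
  mass difference in each cell, plus \<open>C / 2\<close> per unit of mass difference at the level where the climb
  stops. The expected mass difference of a cell is controlled by the variance of a binomial count,
  and Cauchy-Schwarz over the cells of a level gives the square root of the covering number. Each
  case in the definition of \<open>EMult_qL\<close> is one choice of the stopping level: the leaves, the root (where
  the masses agree), or the intermediate level at which \<open>C / 2\<close> is at most the height of the
  parents.\<close>

section \<open>Tree bounds for coupling-Lipschitz functionals\<close>

text \<open>This is Lipschitz continuity with constant \<open>K\<close> for the Wasserstein distance
  of order one under the metric truncated at \<open>C\<close>. Quantifying over couplings makes
  equal total masses automatic and spares the choice of an optimal coupling.\<close>

definition coupling_lipschitz ::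
  "'a::metric_space set \<Rightarrow> real \<Rightarrow> real \<Rightarrow> (('a \<Rightarrow> real) \<Rightarrow> real) \<Rightarrow> bool" where
  "coupling_lipschitz Z C K G \<longleftrightarrow>
    (\<forall>\<gamma>. (\<forall>x y. 0 \<le> \<gamma> x y) \<longrightarrow> (\<forall>x y. x \<notin> Z \<or> y \<notin> Z \<longrightarrow> \<gamma> x y = 0) \<longrightarrow>
      G (\<lambda>y. \<Sum>x\<in>Z. \<gamma> x y) \<le> G (\<lambda>x. \<Sum>y\<in>Z. \<gamma> x y)
        + K * (\<Sum>x\<in>Z. \<Sum>y\<in>Z. \<gamma> x y * min (dist x y) C))"

text \<open>The image measure of \<open>f\<close> on \<open>Z\<close> under \<open>t\<close>. It is
  also used for signed \<open>f\<close>, where its values are the mass differences in the cells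
  \<open>t x = y\<close>.\<close>

definition push :: "'a set \<Rightarrow> ('a \<Rightarrow> 'a) \<Rightarrow> ('a \<Rightarrow> real) \<Rightarrow> 'a \<Rightarrow> real" where
  "push Z t f = (\<lambda>y. \<Sum>x\<in>Z. if t x = y then f x else 0)"

text \<open>Mass that stays in place is put on the diagonal of the coupling, where the truncated
  distance is zero since \<open>0 \<le> C\<close>.\<close>

lemma coupling_lipschitz_add:
  fixes Z :: "'a::metric_space set"
  assumes G: "coupling_lipschitz Z C K G" and "finite Z" "0 \<le> C"
    and \<gamma>: "\<And>x y. 0 \<le> \<gamma> x y" "\<And>x y. x \<notin> Z \<or> y \<notin> Z \<Longrightarrow> \<gamma> x y = 0"
    and m: "\<And>x. 0 \<le> m x" "\<And>x. x \<notin> Z \<Longrightarrow> m x = 0"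
  shows "G (\<lambda>y. m y + (\<Sum>x\<in>Z. \<gamma> x y)) \<le> G (\<lambda>x. m x + (\<Sum>y\<in>Z. \<gamma> x y))
        + K * (\<Sum>x\<in>Z. \<Sum>y\<in>Z. \<gamma> x y * min (dist x y) C)"
proof -
  define \<delta> where "\<delta> = (\<lambda>x y. (if x = y then m x else 0) + \<gamma> x y)"
  have 1: "0 \<le> \<delta> x y" for x y
    using \<gamma>(1) m(1) by (simp add: \<delta>_def)
  have 2: "x \<notin> Z \<or> y \<notin> Z \<Longrightarrow> \<delta> x y = 0" for x y
    using \<gamma>(2) m(2) by (auto simp: \<delta>_def)
  have 3: "(\<lambda>y. \<Sum>x\<in>Z. \<delta> x y) = (\<lambda>y. m y + (\<Sum>x\<in>Z. \<gamma> x y))"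
    using \<open>finite Z\<close> m(2) by (auto simp: \<delta>_def sum.distrib)
  have 4: "(\<lambda>x. \<Sum>y\<in>Z. \<delta> x y) = (\<lambda>x. m x + (\<Sum>y\<in>Z. \<gamma> x y))"
    using \<open>finite Z\<close> m(2) by (auto simp: \<delta>_def sum.distrib)
  have 5: "\<delta> x y * min (dist x y) C = \<gamma> x y * min (dist x y) C" for x y
    using \<open>0 \<le> C\<close> by (auto simp: \<delta>_def)
  have "G (\<lambda>y. \<Sum>x\<in>Z. \<delta> x y) \<le> G (\<lambda>x. \<Sum>y\<in>Z. \<delta> x y)
        + K * (\<Sum>x\<in>Z. \<Sum>y\<in>Z. \<delta> x y * min (dist x y) C)"
    using G[unfolded coupling_lipschitz_def, rule_format, of \<delta>] 1 2 by blast
  then show ?thesis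
    unfolding 3 4 5 .
qed

lemma sum_push:
  assumes "finite Z" "t \<in> Z \<rightarrow> Z"
  shows "(\<Sum>y\<in>Z. push Z t f y) = (\<Sum>x\<in>Z. f x)"
proof -
  have "(\<Sum>y\<in>Z. push Z t f y) = (\<Sum>x\<in>Z. \<Sum>y\<in>Z. if t x = y then f x else 0)"
    unfolding push_def by (rule sum.swap)
  also have "\<dots> = (\<Sum>x\<in>Z. f x)"
    using assms by (intro sum.cong) auto
  finally show ?thesis .
qed

lemma push_diff: "push Z t (\<lambda>x. f x - g x) = (\<lambda>y. push Z t f y - push Z t g y)"
  unfolding push_def by (auto simp flip: sum_subtractf intro!: sum.cong)

lemma push_push:
  assumes "finite Z" "s \<in> Z \<rightarrow> Z"
  shows "push Z t (push Z s f) = push Z (t \<circ> s) f"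
proof
  fix y
  have "push Z t (push Z s f) y = (\<Sum>x\<in>Z. \<Sum>z\<in>Z. if s z = x then (if t x = y then f z else 0) else 0)"
    unfolding push_def
  proof (intro sum.cong refl)
    fix x
    show "(if t x = y then \<Sum>z\<in>Z. if s z = x then f z else 0 else 0)
      = (\<Sum>z\<in>Z. if s z = x then (if t x = y then f z else 0) else 0)"
      by (cases "t x = y") (simp_all cong: if_cong)
  qed
  also have "\<dots> = (\<Sum>z\<in>Z. \<Sum>x\<in>Z. if s z = x then (if t x = y then f z else 0) else 0)"
    by (rule sum.swap)
  also have "\<dots> = (\<Sum>z\<in>Z. if t (s z) = y then f z else 0)"
    using assms by (intro sum.cong) auto
  finally show "push Z t (push Z s f) y = push Z (t \<circ> s) f y"
    by (simp add: push_def)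
qed

lemma push_outside: "t \<in> Z \<rightarrow> Q \<Longrightarrow> y \<notin> Q \<Longrightarrow> push Z t f y = 0"
  unfolding push_def by (intro sum.neutral) auto

lemma push_nonneg: "(\<And>x. 0 \<le> f x) \<Longrightarrow> 0 \<le> push Z t f y"
  unfolding push_def by (simp add: sum_nonneg)

text \<open>The coupling sends all mass at \<open>x\<close> to \<open>t x\<close>, so each unit
  travels at most \<open>r\<close>; its transpose gives the reverse inequality.\<close>

lemma coupling_lipschitz_push:
  fixes Z :: "'a::metric_space set"
  assumes G: "coupling_lipschitz Z C K G" and Z: "finite Z" and "0 \<le> C" "0 \<le> K"
    and t: "t \<in> Z \<rightarrow> Z" "\<And>x. x \<in> Z \<Longrightarrow> dist x (t x) \<le> r"
    and f: "\<And>x. 0 \<le> f x" "\<And>x. x \<notin> Z \<Longrightarrow> f x = 0"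
    and m: "\<And>x. 0 \<le> m x" "\<And>x. x \<notin> Z \<Longrightarrow> m x = 0"
  shows "G (\<lambda>y. m y + push Z t f y) \<le> G (\<lambda>x. m x + f x) + K * (r * (\<Sum>x\<in>Z. f x))"
    and "G (\<lambda>x. m x + f x) \<le> G (\<lambda>y. m y + push Z t f y) + K * (r * (\<Sum>x\<in>Z. f x))"
proof -
  define \<gamma> where "\<gamma> = (\<lambda>x y. if x \<in> Z \<and> t x = y then f x else 0)"
  have 1: "0 \<le> \<gamma> x y" for x y
    using f by (simp add: \<gamma>_def)
  have 2: "\<gamma> x y = 0" if "x \<notin> Z \<or> y \<notin> Z" for x y
    using that t(1) by (auto simp: \<gamma>_def)
  have col: "(\<Sum>x\<in>Z. \<gamma> x y) = push Z t f y" for y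
    unfolding \<gamma>_def push_def by (intro sum.cong) auto
  have row: "(\<Sum>y\<in>Z. \<gamma> x y) = f x" for x
    using Z t(1) f(2) by (cases "x \<in> Z") (auto simp: \<gamma>_def)
  have "(\<Sum>x\<in>Z. \<Sum>y\<in>Z. \<gamma> x y * min (dist x y) C) \<le> (\<Sum>x\<in>Z. \<Sum>y\<in>Z. \<gamma> x y * r)"
  proof (intro sum_mono)
    fix x y assume "x \<in> Z" "y \<in> Z"
    show "\<gamma> x y * min (dist x y) C \<le> \<gamma> x y * r"
      using t(2)[OF \<open>x \<in> Z\<close>] f(1)[of x] by (auto simp: \<gamma>_def intro!: mult_left_mono)
  qed
  also have "\<dots> = r * (\<Sum>x\<in>Z. f x)"
    by (simp add: row mult.commute[of r] flip: sum_distrib_right)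
  finally have cost: "K * (\<Sum>x\<in>Z. \<Sum>y\<in>Z. \<gamma> x y * min (dist x y) C) \<le> K * (r * (\<Sum>x\<in>Z. f x))"
    using \<open>0 \<le> K\<close> by (rule mult_left_mono)
  show "G (\<lambda>y. m y + push Z t f y) \<le> G (\<lambda>x. m x + f x) + K * (r * (\<Sum>x\<in>Z. f x))"
    using coupling_lipschitz_add[where m = m and \<gamma> = \<gamma>, OF G Z \<open>0 \<le> C\<close> 1 2 m] cost
    unfolding row col by linarith
  have "(\<Sum>x\<in>Z. \<Sum>y\<in>Z. \<gamma> y x * min (dist x y) C) = (\<Sum>x\<in>Z. \<Sum>y\<in>Z. \<gamma> x y * min (dist x y) C)"
    by (subst sum.swap) (simp add: dist_commute)
  moreover have "\<gamma> y x = 0" if "x \<notin> Z \<or> y \<notin> Z" for x y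
    using 2 that by blast
  ultimately show "G (\<lambda>x. m x + f x) \<le> G (\<lambda>y. m y + push Z t f y) + K * (r * (\<Sum>x\<in>Z. f x))"
    using coupling_lipschitz_add[where m = m and \<gamma> = "\<lambda>x y. \<gamma> y x", OF G Z \<open>0 \<le> C\<close> 1 _ m] cost
    unfolding row col by simp
qed

text \<open>The normalised product coupling is enough here, because truncation caps the price per
  unit of mass at \<open>C\<close> wherever it goes.\<close>

lemma coupling_lipschitz_product:
  fixes Z :: "'a::metric_space set"
  assumes G: "coupling_lipschitz Z C K G" and Z: "finite Z" and "0 \<le> C" "0 \<le> K"
    and f: "\<And>x. 0 \<le> f x" "\<And>x. x \<notin> Z \<Longrightarrow> f x = 0"
    and g: "\<And>x. 0 \<le> g x" "\<And>x. x \<notin> Z \<Longrightarrow> g x = 0"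
    and m: "\<And>x. 0 \<le> m x" "\<And>x. x \<notin> Z \<Longrightarrow> m x = 0"
    and eq: "(\<Sum>x\<in>Z. f x) = (\<Sum>x\<in>Z. g x)"
  shows "G (\<lambda>x. m x + g x) \<le> G (\<lambda>x. m x + f x) + K * (C * (\<Sum>x\<in>Z. f x))"
proof -
  define M where "M = (\<Sum>x\<in>Z. f x)"
  define \<gamma> where "\<gamma> = (\<lambda>x y. f x * g y / M)"
  have M: "0 \<le> M"
    using f by (simp add: M_def sum_nonneg)
  have 1: "0 \<le> \<gamma> x y" for x y
    using f g M by (simp add: \<gamma>_def)
  have 2: "\<gamma> x y = 0" if "x \<notin> Z \<or> y \<notin> Z" for x y
    using that f g by (auto simp: \<gamma>_def)
  \<comment> \<open>For \<open>M = 0\<close> the quotient defining \<open>\<gamma>\<close> is zero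
    by convention, which has the right marginals because both measures vanish.\<close>
  have zero: "f x = 0 \<and> g x = 0" if "M = 0" for x
    using that eq f g Z unfolding M_def
    by (metis sum_nonneg_eq_0_iff)
  have col: "(\<Sum>x\<in>Z. \<gamma> x y) = g y" for y
    using zero[of y] by (cases "M = 0")
      (auto simp: \<gamma>_def M_def simp flip: sum_distrib_right sum_divide_distrib)
  have row: "(\<Sum>y\<in>Z. \<gamma> x y) = f x" for x
    using zero[of x] by (cases "M = 0")
      (auto simp: \<gamma>_def M_def eq simp flip: sum_distrib_left sum_divide_distrib)
  have "(\<Sum>x\<in>Z. \<Sum>y\<in>Z. \<gamma> x y * min (dist x y) C) \<le> (\<Sum>x\<in>Z. \<Sum>y\<in>Z. \<gamma> x y * C)"
    by (intro sum_mono mult_left_mono 1) auto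
  also have "\<dots> = C * M"
    by (simp add: row M_def mult.commute[of C] flip: sum_distrib_right)
  finally have "K * (\<Sum>x\<in>Z. \<Sum>y\<in>Z. \<gamma> x y * min (dist x y) C) \<le> K * (C * M)"
    using \<open>0 \<le> K\<close> by (rule mult_left_mono)
  then show ?thesis
    using coupling_lipschitz_add[where m = m and \<gamma> = \<gamma>, OF G Z \<open>0 \<le> C\<close> 1 2 m]
    unfolding row col M_def by linarith
qed

text \<open>Only the excess of each measure over the other is moved: it climbs one level of the tree,
  is exchanged at the coarser level by the induction hypothesis, and descends again.\<close>

lemma tree_bound_aux:
  fixes Z :: "'a::metric_space set" and a :: "nat \<Rightarrow> 'a \<Rightarrow> 'a"
  assumes G: "coupling_lipschitz Z C K G" and Z: "finite Z" and C: "0 \<le> C" and K: "0 \<le> K"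
    and a: "\<And>j. a j \<in> Z \<rightarrow> Z"
    and par: "\<And>j. par j \<in> Z \<rightarrow> Z"
    and apar: "\<And>j x. l \<le> j \<Longrightarrow> j < n \<Longrightarrow> x \<in> Z \<Longrightarrow> a j x = par j (a (Suc j) x)"
    and dist: "\<And>j x. x \<in> Z \<Longrightarrow> dist x (par j x) \<le> r j"
    and "l \<le> k" "k \<le> n"
    and f: "\<And>x. 0 \<le> f x" "\<And>x. x \<notin> Z \<Longrightarrow> f x = 0"
    and g: "\<And>x. 0 \<le> g x" "\<And>x. x \<notin> Z \<Longrightarrow> g x = 0"
    and m: "\<And>x. 0 \<le> m x" "\<And>x. x \<notin> Z \<Longrightarrow> m x = 0"
    and \<sigma>0: "(\<Sum>x\<in>Z. \<sigma> x) = 0"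
    and fg: "(\<lambda>x. f x - g x) = push Z (a k) \<sigma>"
  shows "G (\<lambda>x. m x + g x) \<le> G (\<lambda>x. m x + f x)
    + K * ((\<Sum>j\<in>{l..<k}. r j * (\<Sum>y\<in>Z. \<bar>push Z (a (Suc j)) \<sigma> y\<bar>))
           + C / 2 * (\<Sum>y\<in>Z. \<bar>push Z (a l) \<sigma> y\<bar>))"
  using \<open>l \<le> k\<close> \<open>k \<le> n\<close> f g m fg
\<comment> \<open>\<open>m\<close> is generalised because the common part of the two measures stays
  behind at every level and joins the mass already left in place.\<close>
proof (induction k arbitrary: f g m rule: dec_induct)
  case base
  let ?f = "\<lambda>x. max (f x - g x) 0" and ?g = "\<lambda>x. max (g x - f x) 0"
  let ?m = "\<lambda>x. m x + min (f x) (g x)"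
  have "(\<Sum>x\<in>Z. f x - g x) = 0"
    using sum_push[OF Z a, where f = \<sigma>] \<sigma>0 base by (simp add: fun_eq_iff)
  moreover have "(\<Sum>x\<in>Z. ?f x) - (\<Sum>x\<in>Z. ?g x) = (\<Sum>x\<in>Z. f x - g x)"
    by (auto simp flip: sum_subtractf intro!: sum.cong)
  ultimately have eq: "(\<Sum>x\<in>Z. ?f x) = (\<Sum>x\<in>Z. ?g x)"
    by simp
  have "(\<Sum>x\<in>Z. ?f x) + (\<Sum>x\<in>Z. ?g x) = (\<Sum>x\<in>Z. \<bar>f x - g x\<bar>)"
    by (auto simp flip: sum.distrib intro!: sum.cong)
  \<comment> \<open>The two excesses have equal mass and together make up the L1 difference, so only
    half of it is exchanged; this is the source of \<open>C / 2\<close>.\<close>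
  with eq have half: "(\<Sum>x\<in>Z. ?f x) = (\<Sum>x\<in>Z. \<bar>f x - g x\<bar>) / 2"
    by simp
  have "G (\<lambda>x. ?m x + ?g x) \<le> G (\<lambda>x. ?m x + ?f x) + K * (C * (\<Sum>x\<in>Z. ?f x))"
    by (rule coupling_lipschitz_product[OF G Z C K _ _ _ _ _ _ eq]) (use base in auto)
  moreover have "(\<lambda>x. ?m x + ?g x) = (\<lambda>x. m x + g x)" "(\<lambda>x. ?m x + ?f x) = (\<lambda>x. m x + f x)"
    by (auto simp: fun_eq_iff)
  moreover have "(\<Sum>x\<in>Z. \<bar>f x - g x\<bar>) = (\<Sum>y\<in>Z. \<bar>push Z (a l) \<sigma> y\<bar>)"
    using base by (simp add: fun_eq_iff)
  ultimately show ?case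
    using half by simp
next
  case (step k)
  let ?f = "\<lambda>x. max (f x - g x) 0" and ?g = "\<lambda>x. max (g x - f x) 0"
  let ?m = "\<lambda>x. m x + min (f x) (g x)"
  let ?R = "(\<Sum>j\<in>{l..<k}. r j * (\<Sum>y\<in>Z. \<bar>push Z (a (Suc j)) \<sigma> y\<bar>))
           + C / 2 * (\<Sum>y\<in>Z. \<bar>push Z (a l) \<sigma> y\<bar>)"
  note out = push_outside[OF par]
  \<comment> \<open>Compatibility of \<open>a k\<close> with \<open>par k \<circ> a (Suc k)\<close>
    on \<open>Z\<close> makes the lifted excesses differ by the push of the same
    \<open>\<sigma>\<close>, as the induction hypothesis requires.\<close>
  have "push Z (par k) (\<lambda>x. ?f x - ?g x) = push Z (par k) (push Z (a (Suc k)) \<sigma>)"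
    unfolding step.prems(8)[symmetric] by (intro arg_cong[where f = "push Z (par k)"]) auto
  also have "\<dots> = push Z (a k) \<sigma>"
    unfolding push_push[OF Z a] unfolding push_def using apar[of k] step.hyps(1) step.prems(1)
    by (intro ext sum.cong) auto
  finally have diff: "(\<lambda>y. push Z (par k) ?f y - push Z (par k) ?g y) = push Z (a k) \<sigma>"
    unfolding push_diff .
  have sums: "(\<Sum>x\<in>Z. ?f x) + (\<Sum>x\<in>Z. ?g x) = (\<Sum>x\<in>Z. \<bar>push Z (a (Suc k)) \<sigma> x\<bar>)"
    unfolding step.prems(8)[symmetric] by (auto simp flip: sum.distrib intro!: sum.cong)
  \<comment> \<open>Climbing costs \<open>r k\<close> per unit of one excess and descending
    \<open>r k\<close> per unit of the other; by \<open>sums\<close> the two add up to the full L1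
    difference at level \<open>Suc k\<close>.\<close>
  have up: "G (\<lambda>y. ?m y + push Z (par k) ?f y) \<le> G (\<lambda>x. ?m x + ?f x) + K * (r k * (\<Sum>x\<in>Z. ?f x))"
    by (rule coupling_lipschitz_push(1)[OF G Z C K par dist]) (use step.prems in auto)
  have down: "G (\<lambda>x. ?m x + ?g x) \<le> G (\<lambda>y. ?m y + push Z (par k) ?g y) + K * (r k * (\<Sum>x\<in>Z. ?g x))"
    by (rule coupling_lipschitz_push(2)[OF G Z C K par dist]) (use step.prems in auto)
  have mid: "G (\<lambda>y. ?m y + push Z (par k) ?g y) \<le> G (\<lambda>y. ?m y + push Z (par k) ?f y) + K * ?R"
    by (rule step.IH) (use step.prems out diff in \<open>auto intro!: push_nonneg\<close>)
  have "(\<lambda>x. ?m x + ?g x) = (\<lambda>x. m x + g x)" "(\<lambda>x. ?m x + ?f x) = (\<lambda>x. m x + f x)"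
    by (auto simp: fun_eq_iff)
  then have "G (\<lambda>x. m x + g x) \<le> G (\<lambda>x. m x + f x)
      + K * (r k * ((\<Sum>x\<in>Z. ?f x) + (\<Sum>x\<in>Z. ?g x))) + K * ?R"
    using up down mid by (simp add: distrib_left)
  then have "G (\<lambda>x. m x + g x) \<le> G (\<lambda>x. m x + f x)
      + K * (r k * (\<Sum>x\<in>Z. \<bar>push Z (a (Suc k)) \<sigma> x\<bar>) + ?R)"
    unfolding sums distrib_left by simp
  then show ?case
    using step.hyps by (simp add: add_ac)
qed

text \<open>At the leaves the ancestor map is the identity, so the starting difference is
  \<open>\<sigma>\<close> itself. The one-sided bound is used in both directions, since replacing
  \<open>\<sigma>\<close> by its negative does not change the absolute cell differences.\<close>

lemma tree_bound:
  fixes Z :: "'a::metric_space set" and a :: "nat \<Rightarrow> 'a \<Rightarrow> 'a"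
  assumes G: "coupling_lipschitz Z C K G" and Z: "finite Z" and C: "0 \<le> C" and K: "0 \<le> K"
    and a: "\<And>j. a j \<in> Z \<rightarrow> Z" and par: "\<And>j. par j \<in> Z \<rightarrow> Z"
    and apar: "\<And>j x. l \<le> j \<Longrightarrow> j < n \<Longrightarrow> x \<in> Z \<Longrightarrow> a j x = par j (a (Suc j) x)"
    and an: "\<And>x. a n x = x"
    and dist: "\<And>j x. x \<in> Z \<Longrightarrow> dist x (par j x) \<le> r j"
    and "l \<le> n"
    and f: "\<And>x. 0 \<le> f x" "\<And>x. x \<notin> Z \<Longrightarrow> f x = 0"
    and g: "\<And>x. 0 \<le> g x" "\<And>x. x \<notin> Z \<Longrightarrow> g x = 0"
    and eq: "(\<Sum>x\<in>Z. f x) = (\<Sum>x\<in>Z. g x)"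
  defines "\<sigma> \<equiv> (\<lambda>x. f x - g x)"
  shows "\<bar>G f - G g\<bar> \<le> K * ((\<Sum>j\<in>{l..<n}. r j * (\<Sum>y\<in>Z. \<bar>push Z (a (Suc j)) \<sigma> y\<bar>))
           + C / 2 * (\<Sum>y\<in>Z. \<bar>push Z (a l) \<sigma> y\<bar>))"
proof -
  have id: "push Z (a n) h = h" if "\<And>x. x \<notin> Z \<Longrightarrow> h x = 0" for h
    using Z that by (auto simp: push_def an fun_eq_iff)
  have sw: "\<bar>push Z t (\<lambda>x. g x - f x) y\<bar> = \<bar>push Z t (\<lambda>x. f x - g x) y\<bar>" for t y
    unfolding push_diff by simp
  have 1: "G (\<lambda>x. 0 + g x) \<le> G (\<lambda>x. 0 + f x)
    + K * ((\<Sum>j\<in>{l..<n}. r j * (\<Sum>y\<in>Z. \<bar>push Z (a (Suc j)) (\<lambda>x. f x - g x) y\<bar>))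
           + C / 2 * (\<Sum>y\<in>Z. \<bar>push Z (a l) (\<lambda>x. f x - g x) y\<bar>))"
    using eq f g by (intro tree_bound_aux[where n = n and par = par, OF G Z C K a par apar dist \<open>l \<le> n\<close> order.refl])
      (simp_all add: id sum_subtractf)
  have 2: "G (\<lambda>x. 0 + f x) \<le> G (\<lambda>x. 0 + g x)
    + K * ((\<Sum>j\<in>{l..<n}. r j * (\<Sum>y\<in>Z. \<bar>push Z (a (Suc j)) (\<lambda>x. g x - f x) y\<bar>))
           + C / 2 * (\<Sum>y\<in>Z. \<bar>push Z (a l) (\<lambda>x. g x - f x) y\<bar>))"
    using eq f g by (intro tree_bound_aux[where n = n and par = par, OF G Z C K a par apar dist \<open>l \<le> n\<close> order.refl])
      (simp_all add: id sum_subtractf)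
  show ?thesis
    using 1 2 unfolding sw \<sigma>_def by auto
qed

section \<open>Stability of the Kantorovich-Rubinstein cost in its first argument\<close>

text \<open>The case \<open>p = 1\<close> encodes the convention that a zeroth power is one, as
  \<open>0 powr 0 = 0\<close> would otherwise intervene when \<open>min_diam Y C\<close> is
  zero.\<close>

definition lip_const :: "'a::metric_space set \<Rightarrow> real \<Rightarrow> real \<Rightarrow> real" where
  "lip_const Y p C = p * (if p = 1 then 1 else min_diam Y C powr (p - 1))"

text \<open>By the mean value theorem the slope is \<open>p * z powr (p - 1)\<close> at some
  \<open>z\<close> between \<open>b\<close> and \<open>a\<close>, and this grows with
  \<open>z \<le> B\<close>. For \<open>a \<le> b\<close> the left-hand side is not positive.\<close>

lemma powr_diff_le:
  fixes a b B p :: real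
  assumes "0 \<le> a" "0 \<le> b" "a \<le> B" "b \<le> B" "1 \<le> p"
  shows "a powr p - b powr p \<le> p * (if p = 1 then 1 else B powr (p - 1)) * \<bar>a - b\<bar>"
proof (cases "p = 1 \<or> a \<le> b")
  case True
  then show ?thesis
  proof
    assume "a \<le> b"
    then have "a powr p - b powr p \<le> 0"
      using assms by (simp add: powr_mono2)
    also have "0 \<le> p * (if p = 1 then 1 else B powr (p - 1)) * \<bar>a - b\<bar>"
      using assms by simp
    finally show ?thesis .
  qed (use assms in simp)
next
  case False
  then have "b < a" "1 < p"
    using assms by auto
  have "\<exists>l z. b < z \<and> z < a \<and> ((\<lambda>t. t powr p) has_real_derivative l) (at z)
      \<and> a powr p - b powr p = (a - b) * l"
  proof (rule MVT[OF \<open>b < a\<close>])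
    show "continuous_on {b..a} (\<lambda>t. t powr p)"
      using \<open>1 < p\<close> \<open>0 \<le> b\<close> by (intro continuous_on_powr' continuous_intros) auto
    fix x assume "b < x"
    then show "(\<lambda>t. t powr p) differentiable (at x)"
      using \<open>0 \<le> b\<close> by (auto intro!: derivative_eq_intros simp: real_differentiable_def)
  qed
  then obtain l z where z: "b < z" "z < a"
    and l: "((\<lambda>t. t powr p) has_real_derivative l) (at z)"
    and eq: "a powr p - b powr p = (a - b) * l"
    by blast
  have "((\<lambda>t. t powr p) has_real_derivative p * z powr (p - 1)) (at z)"
    using z \<open>0 \<le> b\<close> has_real_derivative_powr[of z p] by simp
  with l have "l = p * z powr (p - 1)"
    by (rule DERIV_unique)
  also have "\<dots> \<le> p * B powr (p - 1)"
    using z assms \<open>1 < p\<close> by (intro mult_left_mono powr_mono2) auto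
  finally have "(a - b) * l \<le> (a - b) * (p * B powr (p - 1))"
    using \<open>b < a\<close> by (intro mult_left_mono) auto
  then show ?thesis
    using eq \<open>b < a\<close> \<open>1 < p\<close> by (simp add: mult.commute)
qed

lemma min_dist_le_min_diam:
  assumes "x \<in> Y" "y \<in> Y"
  shows "min (dist x y) C \<le> min_diam Y C"
  using diameter_bounded_bound[OF _ assms] by (auto simp: min_diam_def)

lemma lip_const_nonneg: "1 \<le> p \<Longrightarrow> 0 \<le> lip_const Y p C"
  by (simp add: lip_const_def)

text \<open>Truncation preserves the triangle inequality, which bounds the change of the base; all
  bases lie below \<open>min_diam Y C\<close>, which bounds the slope of the power.\<close>

lemma truncated_cost_lipschitz:
  assumes "x \<in> Y" "x' \<in> Y" "y \<in> Y" "1 \<le> p" "0 \<le> C"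
  shows "min (dist x' y) C powr p \<le> min (dist x y) C powr p + lip_const Y p C * min (dist x x') C"
proof -
  have "min (dist x' y) C powr p - min (dist x y) C powr p
      \<le> lip_const Y p C * \<bar>min (dist x' y) C - min (dist x y) C\<bar>"
    unfolding lip_const_def using assms min_dist_le_min_diam
    by (intro powr_diff_le) auto
  also have "\<dots> \<le> lip_const Y p C * min (dist x x') C"
  proof (intro mult_left_mono lip_const_nonneg assms)
    have "dist x' y \<le> dist x x' + dist x y" "dist x y \<le> dist x x' + dist x' y"
      by (metis dist_commute dist_triangle)+
    then show "\<bar>min (dist x' y) C - min (dist x y) C\<bar> \<le> min (dist x x') C"
      using \<open>0 \<le> C\<close> zero_le_dist[of x y] zero_le_dist[of x' y] by linarith
  qed
  finally show ?thesis
    by simp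
qed

lemma mass_eq_sum: "finite Z \<Longrightarrow> supp \<mu> \<subseteq> Z \<Longrightarrow> mass \<mu> = (\<Sum>x\<in>Z. \<mu> x)"
  unfolding mass_def by (rule sum.mono_neutral_left) (auto simp: supp_def)

definition plan_cost ::
  "real \<Rightarrow> real \<Rightarrow> ('a::metric_space \<Rightarrow> real) \<Rightarrow> ('a \<Rightarrow> real) \<Rightarrow> ('a \<times> 'a \<Rightarrow> real) \<Rightarrow> real" where
  "plan_cost p C \<mu> \<nu> \<pi> = (\<Sum>(x, x')\<in>supp \<mu> \<times> supp \<nu>. dist x x' powr p * \<pi> (x, x'))
        + C powr p * ((mass \<mu> + mass \<nu>) / 2 - plan_mass \<mu> \<nu> \<pi>)"

lemma KR_pow_altdef: "KR_pow p C \<mu> \<nu> = Inf (plan_cost p C \<mu> \<nu> ` plans \<mu> \<nu>)"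
  unfolding KR_pow_def plan_cost_def ..

text \<open>Merging the penalty for unmatched mass into the weights of the pairs leaves only total
  masses outside the sum. Summing over a fixed \<open>Z\<close> lets plans with different first
  marginals be compared term by term.\<close>

lemma plan_cost_eq:
  assumes Z: "finite Z" "supp \<mu> \<subseteq> Z" and "finite (supp \<nu>)" and \<pi>: "\<pi> \<in> plans \<mu> \<nu>"
  shows "plan_cost p C \<mu> \<nu> \<pi> = (\<Sum>x\<in>Z. \<Sum>y\<in>supp \<nu>. (dist x y powr p - C powr p) * \<pi> (x, y))
    + C powr p * ((mass \<mu> + mass \<nu>) / 2)"
proof -
  have "plan_cost p C \<mu> \<nu> \<pi> = (\<Sum>(x, y)\<in>supp \<mu> \<times> supp \<nu>. (dist x y powr p - C powr p) * \<pi> (x, y))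
    + C powr p * ((mass \<mu> + mass \<nu>) / 2)"
    unfolding plan_cost_def plan_mass_def
    by (simp add: algebra_simps sum_distrib_left sum_subtractf case_prod_unfold)
  also have "(\<Sum>(x, y)\<in>supp \<mu> \<times> supp \<nu>. (dist x y powr p - C powr p) * \<pi> (x, y))
    = (\<Sum>x\<in>supp \<mu>. \<Sum>y\<in>supp \<nu>. (dist x y powr p - C powr p) * \<pi> (x, y))"
    by (simp add: sum.cartesian_product)
  also have "\<dots> = (\<Sum>x\<in>Z. \<Sum>y\<in>supp \<nu>. (dist x y powr p - C powr p) * \<pi> (x, y))"
    using Z \<pi> by (intro sum.mono_neutral_left) (auto simp: plans_def)
  finally show ?thesis .
qed

text \<open>A plan carries at most the mass of either marginal, hence at most their average. The
  resulting lower bound is what makes the infimum in \<open>KR_pow\<close> lie below the cost of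
  each plan.\<close>

lemma plan_cost_nonneg:
  assumes "finite (supp \<mu>)" "finite (supp \<nu>)" and \<pi>: "\<pi> \<in> plans \<mu> \<nu>"
  shows "0 \<le> plan_cost p C \<mu> \<nu> \<pi>"
proof -
  have "plan_mass \<mu> \<nu> \<pi> = (\<Sum>x\<in>supp \<mu>. \<Sum>y\<in>supp \<nu>. \<pi> (x, y))"
    by (simp add: plan_mass_def sum.cartesian_product)
  moreover have "(\<Sum>x\<in>supp \<mu>. \<Sum>y\<in>supp \<nu>. \<pi> (x, y)) \<le> mass \<mu>"
    unfolding mass_def using \<pi> by (intro sum_mono) (simp add: plans_def)
  moreover have "(\<Sum>x\<in>supp \<mu>. \<Sum>y\<in>supp \<nu>. \<pi> (x, y)) \<le> mass \<nu>"
    unfolding mass_def using \<pi> by (subst sum.swap, intro sum_mono) (simp add: plans_def)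
  ultimately have "0 \<le> (mass \<mu> + mass \<nu>) / 2 - plan_mass \<mu> \<nu> \<pi>"
    by simp
  then show ?thesis
    unfolding plan_cost_def using \<pi> by (auto simp: plans_def intro!: add_nonneg_nonneg sum_nonneg)
qed

lemma zero_mem_plans: "(\<And>x. 0 \<le> \<mu> x) \<Longrightarrow> (\<And>x. 0 \<le> \<nu> x) \<Longrightarrow> (\<lambda>_. 0) \<in> plans \<mu> \<nu>"
  by (simp add: plans_def)

text \<open>Composing a plan from the first marginal of \<open>\<gamma>\<close> with \<open>\<gamma>\<close> gives a plan from the second
  marginal; its cost is compared after truncating the metric at \<open>C\<close>, which is free of charge
  since a plan may simply leave out the pairs at distance more than \<open>C\<close>.\<close>

lemma KR_pow_coupling_lipschitz:
  fixes Y :: "'a::metric_space set"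
  assumes Z: "finite Z" "Z \<subseteq> Y" and p: "1 \<le> p" and C: "0 \<le> C" and \<nu>: "fsmeas Y \<nu>"
  shows "coupling_lipschitz Z C (lip_const Y p C) (\<lambda>\<mu>. KR_pow p C \<mu> \<nu>)"
  unfolding coupling_lipschitz_def
proof (intro allI impI)
  fix \<gamma> :: "'a \<Rightarrow> 'a \<Rightarrow> real"
  assume "\<forall>x y. 0 \<le> \<gamma> x y" and "\<forall>x y. x \<notin> Z \<or> y \<notin> Z \<longrightarrow> \<gamma> x y = 0"
  then have \<gamma>: "\<And>x y. 0 \<le> \<gamma> x y" "\<And>x y. x \<notin> Z \<or> y \<notin> Z \<Longrightarrow> \<gamma> x y = 0"
    by auto
  define \<mu> where "\<mu> = (\<lambda>x. \<Sum>x'\<in>Z. \<gamma> x x')"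
  define \<mu>' where "\<mu>' = (\<lambda>x'. \<Sum>x\<in>Z. \<gamma> x x')"
  define V where "V = supp \<nu>"
  define K where "K = lip_const Y p C"
  define W where "W = (\<Sum>x\<in>Z. \<Sum>x'\<in>Z. \<gamma> x x' * min (dist x x') C)"
  define c where "c = (\<lambda>(x::'a) y. min (dist x y) C powr p - C powr p)"
  have V: "finite V" "V \<subseteq> Y" and \<nu>0: "\<And>y. 0 \<le> \<nu> y"
    using \<nu> by (auto simp: fsmeas_def V_def)
  have K: "0 \<le> K"
    unfolding K_def by (rule lip_const_nonneg[OF p])
  have \<mu>0: "0 \<le> \<mu> x" "0 \<le> \<mu>' x" for x
    using \<gamma>(1) by (simp_all add: \<mu>_def \<mu>'_def sum_nonneg)
  have supp: "supp \<mu> \<subseteq> Z" "supp \<mu>' \<subseteq> Z"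
    using \<gamma>(2) unfolding supp_def \<mu>_def \<mu>'_def by (auto intro: ccontr)
  have fin: "finite (supp \<mu>)" "finite (supp \<mu>')"
    using supp Z by (auto intro: finite_subset)
  have mass_eq: "mass \<mu>' = mass \<mu>"
    using mass_eq_sum[OF Z(1) supp(1)] mass_eq_sum[OF Z(1) supp(2)] sum.swap[of \<gamma> Z Z]
    by (simp add: \<mu>_def \<mu>'_def)
  have "KR_pow p C \<mu>' \<nu> - K * W \<le> plan_cost p C \<mu> \<nu> \<pi>" if \<pi>: "\<pi> \<in> plans \<mu> \<nu>" for \<pi>
  proof -
    have \<pi>0: "0 \<le> \<pi> z" for z
      using \<pi> by (cases z) (simp add: plans_def)
    have \<pi>out: "\<pi> (x, y) = 0" if "\<mu> x = 0 \<or> y \<notin> V" for x y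
      using \<pi> that by (auto simp: plans_def supp_def V_def)
    have row: "(\<Sum>y\<in>V. \<pi> (x, y)) \<le> \<mu> x" for x
      using \<pi> by (simp add: plans_def V_def)
    have "(\<Sum>x\<in>supp \<mu>. \<pi> (x, y)) = (\<Sum>x\<in>Z. \<pi> (x, y))" for y
      using Z supp \<pi>out by (intro sum.mono_neutral_left) (auto simp: supp_def)
    then have col: "(\<Sum>x\<in>Z. \<pi> (x, y)) \<le> \<nu> y" for y
      using \<pi> by (simp add: plans_def)
    \<comment> \<open>Gluing: the mass that \<open>\<pi>\<close> sends from \<open>x\<close> to
      \<open>y\<close> is split among the \<open>x'\<close> in proportion to
      \<open>\<gamma> x x'\<close>. If \<open>\<mu> x = 0\<close>, the convention for division gives
      zero, in agreement with \<open>\<pi>out\<close>.\<close>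
    define \<kappa> where "\<kappa> = (\<lambda>x x' y. \<gamma> x x' * \<pi> (x, y) / \<mu> x)"
    have \<kappa>0: "0 \<le> \<kappa> x x' y" for x x' y
      unfolding \<kappa>_def using \<gamma>(1) \<pi>0 \<mu>0 by simp
    have \<kappa>_x': "(\<Sum>x'\<in>Z. \<kappa> x x' y) = \<pi> (x, y)" for x y
      using \<pi>out[of x y] unfolding \<kappa>_def
      by (cases "\<mu> x = 0") (auto simp: \<mu>_def simp flip: sum_distrib_right sum_divide_distrib)
    \<comment> \<open>Only an inequality, because \<open>\<pi>\<close> may leave part of
      \<open>\<mu> x\<close> unmatched.\<close>
    have \<kappa>_y: "(\<Sum>y\<in>V. \<kappa> x x' y) \<le> \<gamma> x x'" for x x'
    proof (cases "\<mu> x = 0")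
      case False
      have "(\<Sum>y\<in>V. \<kappa> x x' y) = \<gamma> x x' * (\<Sum>y\<in>V. \<pi> (x, y)) / \<mu> x"
        unfolding \<kappa>_def by (simp add: sum_distrib_left sum_divide_distrib)
      also have "\<dots> \<le> \<gamma> x x' * \<mu> x / \<mu> x"
        using \<gamma>(1) row \<mu>0 by (intro divide_right_mono mult_left_mono) auto
      finally show ?thesis
        using False by simp
    qed (simp add: \<kappa>_def \<gamma>)
    define \<pi>' where "\<pi>' = (\<lambda>(x', y). if dist x' y \<le> C then \<Sum>x\<in>Z. \<kappa> x x' y else 0)"
    have \<pi>'le: "\<pi>' (x', y) \<le> (\<Sum>x\<in>Z. \<kappa> x x' y)" for x' y
      using \<kappa>0 by (auto simp: \<pi>'_def sum_nonneg)
    have "\<pi>' \<in> plans \<mu>' \<nu>"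
      unfolding plans_def
    proof (intro CollectI conjI allI impI)
      show "0 \<le> \<pi>' z" for z
        using \<kappa>0 by (cases z) (auto simp: \<pi>'_def sum_nonneg)
      show "\<pi>' (x', y) = 0" if "x' \<notin> supp \<mu>' \<or> y \<notin> supp \<nu>" for x' y
        using that
      proof
        assume "x' \<notin> supp \<mu>'"
        then have "(\<Sum>x\<in>Z. \<gamma> x x') = 0"
          by (simp add: supp_def \<mu>'_def)
        then have "\<forall>x\<in>Z. \<gamma> x x' = 0"
          using \<gamma>(1) Z(1) by (simp add: sum_nonneg_eq_0_iff)
        then show ?thesis
          by (auto simp: \<pi>'_def \<kappa>_def intro!: sum.neutral)
      qed (auto simp: \<pi>'_def \<kappa>_def \<pi>out V_def)
      show "(\<Sum>y\<in>supp \<nu>. \<pi>' (x', y)) \<le> \<mu>' x'" for x'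
      proof -
        have "(\<Sum>y\<in>supp \<nu>. \<pi>' (x', y)) \<le> (\<Sum>y\<in>V. \<Sum>x\<in>Z. \<kappa> x x' y)"
          unfolding V_def by (intro sum_mono \<pi>'le)
        also have "\<dots> = (\<Sum>x\<in>Z. \<Sum>y\<in>V. \<kappa> x x' y)"
          by (rule sum.swap)
        also have "\<dots> \<le> \<mu>' x'"
          unfolding \<mu>'_def by (intro sum_mono \<kappa>_y)
        finally show ?thesis .
      qed
      show "(\<Sum>x'\<in>supp \<mu>'. \<pi>' (x', y)) \<le> \<nu> y" for y
      proof -
        have "(\<Sum>x'\<in>supp \<mu>'. \<pi>' (x', y)) \<le> (\<Sum>x'\<in>supp \<mu>'. \<Sum>x\<in>Z. \<kappa> x x' y)"
          by (intro sum_mono \<pi>'le)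
        also have "\<dots> \<le> (\<Sum>x'\<in>Z. \<Sum>x\<in>Z. \<kappa> x x' y)"
          using Z(1) supp \<kappa>0 by (intro sum_mono2) (auto simp: sum_nonneg)
        also have "\<dots> = (\<Sum>x\<in>Z. \<pi> (x, y))"
          by (subst sum.swap) (simp add: \<kappa>_x')
        also have "\<dots> \<le> \<nu> y"
          by (rule col)
        finally show ?thesis .
      qed
    qed
    then have "KR_pow p C \<mu>' \<nu> \<le> plan_cost p C \<mu>' \<nu> \<pi>'"
      unfolding KR_pow_altdef
      by (intro cINF_lower) (use plan_cost_nonneg fin V in \<open>auto intro!: bdd_belowI[of _ 0] simp: V_def\<close>)
    also have "\<dots> = (\<Sum>x'\<in>Z. \<Sum>y\<in>V. (dist x' y powr p - C powr p) * \<pi>' (x', y))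
      + C powr p * ((mass \<mu> + mass \<nu>) / 2)"
      using plan_cost_eq[OF Z(1) supp(2) _ \<open>\<pi>' \<in> plans \<mu>' \<nu>\<close>] V mass_eq by (simp add: V_def)
    \<comment> \<open>Beyond distance \<open>C\<close> both sides vanish: \<open>\<pi>'\<close> is
      zero there on the left, and the truncated weight \<open>c\<close> is zero on the
      right.\<close>
    also have "(\<Sum>x'\<in>Z. \<Sum>y\<in>V. (dist x' y powr p - C powr p) * \<pi>' (x', y))
      = (\<Sum>x'\<in>Z. \<Sum>y\<in>V. c x' y * (\<Sum>x\<in>Z. \<kappa> x x' y))"
      by (intro sum.cong refl) (auto simp: \<pi>'_def c_def min_def)
    also have "\<dots> = (\<Sum>x'\<in>Z. \<Sum>y\<in>V. \<Sum>x\<in>Z. c x' y * \<kappa> x x' y)"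
      by (simp add: sum_distrib_left)
    also have "\<dots> \<le> (\<Sum>x'\<in>Z. \<Sum>y\<in>V. \<Sum>x\<in>Z. c x y * \<kappa> x x' y + K * min (dist x x') C * \<kappa> x x' y)"
    proof (intro sum_mono)
      fix x' y x assume "x' \<in> Z" "y \<in> V" "x \<in> Z"
      then have "c x' y \<le> c x y + K * min (dist x x') C"
        using truncated_cost_lipschitz[of x Y x' y p C] Z V p C by (auto simp: c_def K_def)
      then have "c x' y * \<kappa> x x' y \<le> (c x y + K * min (dist x x') C) * \<kappa> x x' y"
        using \<kappa>0 by (rule mult_right_mono)
      then show "c x' y * \<kappa> x x' y \<le> c x y * \<kappa> x x' y + K * min (dist x x') C * \<kappa> x x' y"
        by (simp add: distrib_right)
    qed
    also have "\<dots> = (\<Sum>x'\<in>Z. \<Sum>y\<in>V. \<Sum>x\<in>Z. c x y * \<kappa> x x' y)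
        + (\<Sum>x'\<in>Z. \<Sum>y\<in>V. \<Sum>x\<in>Z. K * min (dist x x') C * \<kappa> x x' y)"
      by (simp add: sum.distrib)
    also have "(\<Sum>x'\<in>Z. \<Sum>y\<in>V. \<Sum>x\<in>Z. c x y * \<kappa> x x' y) = (\<Sum>x\<in>Z. \<Sum>y\<in>V. c x y * \<pi> (x, y))"
    proof -
      have "(\<Sum>x'\<in>Z. \<Sum>y\<in>V. \<Sum>x\<in>Z. c x y * \<kappa> x x' y) = (\<Sum>y\<in>V. \<Sum>x'\<in>Z. \<Sum>x\<in>Z. c x y * \<kappa> x x' y)"
        by (rule sum.swap)
      also have "\<dots> = (\<Sum>y\<in>V. \<Sum>x\<in>Z. \<Sum>x'\<in>Z. c x y * \<kappa> x x' y)"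
        by (intro sum.cong refl sum.swap)
      also have "\<dots> = (\<Sum>y\<in>V. \<Sum>x\<in>Z. c x y * \<pi> (x, y))"
        by (simp add: \<kappa>_x' flip: sum_distrib_left)
      also have "\<dots> = (\<Sum>x\<in>Z. \<Sum>y\<in>V. c x y * \<pi> (x, y))"
        by (rule sum.swap)
      finally show ?thesis .
    qed
    \<comment> \<open>The given plan may still use pairs farther apart than \<open>C\<close>;
      truncation only lowers their weight.\<close>
    also have "\<dots> \<le> (\<Sum>x\<in>Z. \<Sum>y\<in>V. (dist x y powr p - C powr p) * \<pi> (x, y))"
      using C p \<pi>0 by (intro sum_mono mult_right_mono) (auto simp: c_def intro!: powr_mono2)
    also have "(\<Sum>x'\<in>Z. \<Sum>y\<in>V. \<Sum>x\<in>Z. K * min (dist x x') C * \<kappa> x x' y) \<le> K * W"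
    proof -
      have "(\<Sum>x'\<in>Z. \<Sum>y\<in>V. \<Sum>x\<in>Z. K * min (dist x x') C * \<kappa> x x' y)
        = (\<Sum>x'\<in>Z. \<Sum>x\<in>Z. \<Sum>y\<in>V. K * min (dist x x') C * \<kappa> x x' y)"
        by (intro sum.cong refl sum.swap)
      also have "\<dots> = (\<Sum>x'\<in>Z. \<Sum>x\<in>Z. K * min (dist x x') C * (\<Sum>y\<in>V. \<kappa> x x' y))"
        by (simp add: sum_distrib_left)
      also have "\<dots> \<le> (\<Sum>x'\<in>Z. \<Sum>x\<in>Z. K * min (dist x x') C * \<gamma> x x')"
        using K C by (intro sum_mono mult_left_mono \<kappa>_y) auto
      also have "\<dots> = (\<Sum>x\<in>Z. \<Sum>x'\<in>Z. K * min (dist x x') C * \<gamma> x x')"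
        by (rule sum.swap)
      also have "\<dots> = K * W"
        by (simp add: W_def sum_distrib_left mult_ac)
      finally show ?thesis .
    qed
    also have "(\<Sum>x\<in>Z. \<Sum>y\<in>V. (dist x y powr p - C powr p) * \<pi> (x, y)) + K * W
        + C powr p * ((mass \<mu> + mass \<nu>) / 2) = plan_cost p C \<mu> \<nu> \<pi> + K * W"
      using plan_cost_eq[OF Z(1) supp(1) _ \<pi>] V by (simp add: V_def)
    finally show ?thesis
      by simp
  qed
  then have "KR_pow p C \<mu>' \<nu> - K * W \<le> KR_pow p C \<mu> \<nu>"
    unfolding KR_pow_altdef[of p C \<mu> \<nu>]
    by (intro cINF_greatest) (use zero_mem_plans[of \<mu> \<nu>] \<mu>0 \<nu>0 in auto)
  then show "KR_pow p C (\<lambda>y. \<Sum>x\<in>Z. \<gamma> x y) \<nu> \<le> KR_pow p C (\<lambda>x. \<Sum>y\<in>Z. \<gamma> x y) \<nu>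
      + lip_const Y p C * (\<Sum>x\<in>Z. \<Sum>y\<in>Z. \<gamma> x y * min (dist x y) C)"
    by (simp add: \<mu>_def \<mu>'_def K_def W_def)
qed

section \<open>Fluctuations of the multinomial estimator\<close>

lemma finite_set_replicate_pmf:
  assumes "finite (set_pmf P)"
  shows "finite (set_pmf (replicate_pmf n P))"
  using finite_lists_length_eq[OF assms, of n] by (simp add: set_replicate_pmf lists_eq_set)

lemma expectation_replicate_pmf_Suc:
  fixes h :: "'a list \<Rightarrow> real"
  assumes "finite (set_pmf P)"
  shows "measure_pmf.expectation (replicate_pmf (Suc n) P) h
    = (\<Sum>x\<in>set_pmf P. pmf P x * measure_pmf.expectation (replicate_pmf n P) (\<lambda>xs. h (x # xs)))"
proof -
  have "replicate_pmf (Suc n) P = P \<bind> (\<lambda>x. map_pmf ((#) x) (replicate_pmf n P))"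
    by (simp add: map_pmf_def)
  then show ?thesis
    using assms finite_set_replicate_pmf[OF assms, of n]
    by (simp only:) (subst pmf_expectation_bind[of "set_pmf P"], auto)
qed

text \<open>The recursion is on the first draw: the remaining sum has mean zero and is independent
  of it, so the cross term in the square disappears and the variances add up.\<close>

lemma moments_sum_list_replicate_pmf:
  fixes h :: "'a \<Rightarrow> real"
  assumes fin: "finite (set_pmf P)" and h0: "measure_pmf.expectation P h = 0"
  shows "measure_pmf.expectation (replicate_pmf n P) (\<lambda>xs. sum_list (map h xs)) = 0"
    and "measure_pmf.expectation (replicate_pmf n P) (\<lambda>xs. (sum_list (map h xs))\<^sup>2)
      = real n * measure_pmf.expectation P (\<lambda>x. (h x)\<^sup>2)"
proof (induction n)
  case 0
  {
    case 1
    then show ?case by simp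
  next
    case 2
    then show ?case by simp
  }
next
  case (Suc n)
  let ?E = "measure_pmf.expectation (replicate_pmf n P)"
  let ?S = "\<lambda>xs. sum_list (map h xs)"
  have int: "integrable (measure_pmf (replicate_pmf n P)) f" for f :: "'a list \<Rightarrow> real"
    by (intro integrable_measure_pmf_finite finite_set_replicate_pmf fin)
  have sum1: "(\<Sum>x\<in>set_pmf P. pmf P x) = 1"
    using fin by (simp add: sum_pmf_eq_1)
  have sumh: "(\<Sum>x\<in>set_pmf P. pmf P x * h x) = 0"
    using h0 fin by (subst (asm) integral_measure_pmf[of "set_pmf P"]) auto
  have sumh2: "(\<Sum>x\<in>set_pmf P. pmf P x * (h x)\<^sup>2) = measure_pmf.expectation P (\<lambda>x. (h x)\<^sup>2)"
    using fin by (subst integral_measure_pmf[of "set_pmf P"]) auto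
  {
    case 1
    have "?E (\<lambda>xs. ?S (x # xs)) = h x" for x
      using Suc int by simp
    then show ?case
      using fin sumh by (simp only: expectation_replicate_pmf_Suc)
  next
    case 2
    have "?E (\<lambda>xs. (?S (x # xs))\<^sup>2) = (h x)\<^sup>2 + real n * measure_pmf.expectation P (\<lambda>x. (h x)\<^sup>2)" for x
      using Suc int by (simp add: power2_sum mult.assoc)
    moreover have "(\<Sum>x\<in>set_pmf P. pmf P x * ((h x)\<^sup>2 + c))
        = (\<Sum>x\<in>set_pmf P. pmf P x * (h x)\<^sup>2) + (\<Sum>x\<in>set_pmf P. pmf P x) * c" for c
      by (simp add: distrib_left sum.distrib sum_distrib_right)
    ultimately show ?case
      by (simp only: expectation_replicate_pmf_Suc[OF fin] sum1 sumh2) (simp add: algebra_simps)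
  }
qed

text \<open>This is nonnegativity of the variance of \<open>\<bar>h x\<bar>\<close>.\<close>

lemma expectation_abs_le_sqrt:
  fixes h :: "'a \<Rightarrow> real"
  assumes "finite (set_pmf P)"
  shows "measure_pmf.expectation P (\<lambda>x. \<bar>h x\<bar>) \<le> sqrt (measure_pmf.expectation P (\<lambda>x. (h x)\<^sup>2))"
proof -
  have "(measure_pmf.expectation P (\<lambda>x. \<bar>h x\<bar>))\<^sup>2 \<le> measure_pmf.expectation P (\<lambda>x. (h x)\<^sup>2)"
    using measure_pmf.variance_positive[of P "\<lambda>x. \<bar>h x\<bar>"]
    by (subst (asm) measure_pmf.variance_eq) (auto intro!: integrable_measure_pmf_finite assms)
  then show ?thesis
    by (rule real_le_rsqrt)
qed

text \<open>The deviation is, up to sign, the mean of \<open>n\<close> independent centred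
  indicators of \<open>S\<close>, each with variance at most \<open>measure P S\<close>, and a first
  absolute moment is at most the root of the second moment.\<close>

lemma expectation_sample_frequency:
  assumes fin: "finite (set_pmf P)" and "0 < n"
  shows "measure_pmf.expectation (replicate_pmf n P)
      (\<lambda>xs. \<bar>measure P S - real (length (filter (\<lambda>x. x \<in> S) xs)) / real n\<bar>)
    \<le> sqrt (measure P S / real n)"
proof -
  define h where "h = (\<lambda>x. indicat_real S x - measure P S)"
  note int = integrable_measure_pmf_finite[OF fin]
  have h0: "measure_pmf.expectation P h = 0"
    unfolding h_def by (simp add: int)
  \<comment> \<open>An indicator equals its square, so the integrand is affine in it.\<close>
  have "measure_pmf.expectation P (\<lambda>x. (h x)\<^sup>2)
      = measure_pmf.expectation P (\<lambda>x. indicat_real S x * (1 - 2 * measure P S) + (measure P S)\<^sup>2)"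
    by (intro Bochner_Integration.integral_cong)
      (auto simp: h_def power2_eq_square algebra_simps indicator_def)
  also have "\<dots> = measure P S - (measure P S)\<^sup>2"
    by (simp add: int power2_eq_square algebra_simps)
  finally have h2: "measure_pmf.expectation P (\<lambda>x. (h x)\<^sup>2) \<le> measure P S"
    by simp
  have sum_h: "sum_list (map h xs) = real (length (filter (\<lambda>x. x \<in> S) xs)) - real (length xs) * measure P S" for xs
    by (induction xs) (auto simp: h_def algebra_simps)
  have "measure_pmf.expectation (replicate_pmf n P)
      (\<lambda>xs. \<bar>measure P S - real (length (filter (\<lambda>x. x \<in> S) xs)) / real n\<bar>)
    = measure_pmf.expectation (replicate_pmf n P) (\<lambda>xs. \<bar>sum_list (map h xs)\<bar> / real n)"
  proof (intro integral_cong_AE)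
    show "AE xs in replicate_pmf n P. \<bar>measure P S - real (length (filter (\<lambda>x. x \<in> S) xs)) / real n\<bar>
        = \<bar>sum_list (map h xs)\<bar> / real n"
      using \<open>0 < n\<close> by (auto simp: AE_measure_pmf_iff set_replicate_pmf sum_h field_simps abs_minus_commute
          simp flip: abs_divide[of _ "real n", simplified])
  qed auto
  also have "\<dots> = measure_pmf.expectation (replicate_pmf n P) (\<lambda>xs. \<bar>sum_list (map h xs)\<bar>) / real n"
    by simp
  also have "\<dots> \<le> sqrt (real n * measure P S) / real n"
  proof (intro divide_right_mono)
    have "measure_pmf.expectation (replicate_pmf n P) (\<lambda>xs. \<bar>sum_list (map h xs)\<bar>)
        \<le> sqrt (measure_pmf.expectation (replicate_pmf n P) (\<lambda>xs. (sum_list (map h xs))\<^sup>2))"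
      by (intro expectation_abs_le_sqrt finite_set_replicate_pmf fin)
    also have "\<dots> \<le> sqrt (real n * measure P S)"
      unfolding moments_sum_list_replicate_pmf(2)[OF fin h0] using h2
      by (intro real_sqrt_le_mono mult_left_mono) auto
    finally show "measure_pmf.expectation (replicate_pmf n P) (\<lambda>xs. \<bar>sum_list (map h xs)\<bar>)
        \<le> sqrt (real n * measure P S)" .
  qed simp
  also have "\<dots> = sqrt (measure P S / real n)"
    using \<open>0 < n\<close> by (simp add: real_sqrt_mult real_sqrt_divide field_simps)
  finally show ?thesis .
qed

lemma
  fixes \<mu> :: "'a \<Rightarrow> real"
  assumes "\<And>x. 0 \<le> \<mu> x" and "finite (supp \<mu>)" and "0 < mass \<mu>"
  shows pmf_normalised_pmf: "pmf (normalised_pmf \<mu>) x = \<mu> x / mass \<mu>"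
    and set_normalised_pmf: "set_pmf (normalised_pmf \<mu>) = supp \<mu>"
proof -
  have "(\<integral>\<^sup>+ x. ennreal (\<mu> x / mass \<mu>) \<partial>count_space UNIV)
      = (\<integral>\<^sup>+ x. ennreal (\<mu> x / mass \<mu>) \<partial>count_space (supp \<mu>))"
    by (rule nn_integral_count_space_eq) (auto simp: supp_def)
  also have "\<dots> = (\<Sum>x\<in>supp \<mu>. ennreal (\<mu> x / mass \<mu>))"
    using assms by (simp add: nn_integral_count_space_finite)
  also have "\<dots> = ennreal (\<Sum>x\<in>supp \<mu>. \<mu> x / mass \<mu>)"
    using assms by (intro sum_ennreal) simp
  also have "(\<Sum>x\<in>supp \<mu>. \<mu> x / mass \<mu>) = 1"
    using assms by (simp add: mass_def flip: sum_divide_distrib)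
  finally have 1: "(\<integral>\<^sup>+ x. ennreal (\<mu> x / mass \<mu>) \<partial>count_space UNIV) = 1"
    by simp
  show "pmf (normalised_pmf \<mu>) x = \<mu> x / mass \<mu>"
    unfolding normalised_pmf_def using assms 1 by (intro pmf_embed_pmf) auto
  show "set_pmf (normalised_pmf \<mu>) = supp \<mu>"
    unfolding normalised_pmf_def using assms 1 by (subst set_embed_pmf) (auto simp: supp_def)
qed

lemma sum_count_list_if:
  assumes "finite Z" "set xs \<subseteq> Z"
  shows "(\<Sum>x\<in>Z. if Q x then real (count_list xs x) else 0) = real (length (filter Q xs))"
  using assms(2)
proof (induction xs)
  case (Cons a xs)
  have "(\<Sum>x\<in>Z. if Q x then real (count_list (a # xs) x) else 0)
    = (\<Sum>x\<in>Z. (if Q x then real (count_list xs x) else 0) + (if a = x then (if Q a then 1 else 0) else 0))"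
    by (intro sum.cong) auto
  also have "\<dots> = real (length (filter Q (a # xs)))"
    using Cons assms(1) by (simp add: sum.distrib)
  finally show ?case .
qed (simp cong: if_cong)

text \<open>The pushed difference at \<open>y\<close> is, in absolute value,
  \<open>mass \<mu>\<close> times the error of a sample frequency for the cell \<open>S\<close> of
  points sent to \<open>y\<close>. This identity holds on the support of the sampling law, whose
  samples stay inside \<open>supp \<mu>\<close>.\<close>

lemma expectation_abs_push:
  fixes \<mu> :: "'a \<Rightarrow> real"
  assumes \<mu>: "\<And>x. 0 \<le> \<mu> x" "finite (supp \<mu>)" "0 < mass \<mu>" and "0 < n"
  shows "measure_pmf.expectation (replicate_pmf n (normalised_pmf \<mu>))
      (\<lambda>xs. \<bar>push (supp \<mu>) t (\<lambda>x. \<mu> x - emp_est \<mu> xs x) y\<bar>)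
    \<le> sqrt (mass \<mu>) * sqrt (push (supp \<mu>) t \<mu> y) / sqrt (real n)"
proof -
  let ?P = "normalised_pmf \<mu>"
  define S where "S = {x\<in>supp \<mu>. t x = y}"
  have fin: "finite (set_pmf ?P)"
    using \<mu> by (simp add: set_normalised_pmf)
  have pS: "push (supp \<mu>) t \<mu> y = mass \<mu> * measure ?P S"
  proof -
    have "push (supp \<mu>) t \<mu> y = (\<Sum>x\<in>S. \<mu> x)"
      unfolding push_def S_def using \<mu>(2) by (simp add: sum.inter_filter)
    also have "\<dots> = mass \<mu> * (\<Sum>x\<in>S. \<mu> x / mass \<mu>)"
      using \<mu>(3) by (simp flip: sum_divide_distrib)
    also have "\<dots> = mass \<mu> * measure ?P S"
      using \<mu> by (subst measure_measure_pmf_finite) (auto simp: S_def pmf_normalised_pmf)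
    finally show ?thesis .
  qed
  have "measure_pmf.expectation (replicate_pmf n ?P)
      (\<lambda>xs. \<bar>push (supp \<mu>) t (\<lambda>x. \<mu> x - emp_est \<mu> xs x) y\<bar>)
    = measure_pmf.expectation (replicate_pmf n ?P)
      (\<lambda>xs. mass \<mu> * \<bar>measure ?P S - real (length (filter (\<lambda>x. x \<in> S) xs)) / real n\<bar>)"
  proof (intro integral_cong_AE)
    show "AE xs in replicate_pmf n ?P. \<bar>push (supp \<mu>) t (\<lambda>x. \<mu> x - emp_est \<mu> xs x) y\<bar>
      = mass \<mu> * \<bar>measure ?P S - real (length (filter (\<lambda>x. x \<in> S) xs)) / real n\<bar>"
      unfolding AE_measure_pmf_iff
    proof
      fix xs assume "xs \<in> set_pmf (replicate_pmf n ?P)"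
      then have xs: "set xs \<subseteq> supp \<mu>" "length xs = n"
        using \<mu> by (auto simp: set_replicate_pmf set_normalised_pmf)
      have "push (supp \<mu>) t (emp_est \<mu> xs) y
          = mass \<mu> / real n * (\<Sum>x\<in>supp \<mu>. if t x = y then real (count_list xs x) else 0)"
        unfolding push_def emp_est_def xs(2) sum_distrib_left by (intro sum.cong) auto
      also have "\<dots> = mass \<mu> / real n * real (length (filter (\<lambda>x. t x = y) xs))"
        using sum_count_list_if[OF \<mu>(2) xs(1)] by simp
      also have "filter (\<lambda>x. t x = y) xs = filter (\<lambda>x. x \<in> S) xs"
        using xs by (intro filter_cong) (auto simp: S_def)
      finally have "push (supp \<mu>) t (\<lambda>x. \<mu> x - emp_est \<mu> xs x) y
        = mass \<mu> * (measure ?P S - real (length (filter (\<lambda>x. x \<in> S) xs)) / real n)"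
        unfolding push_diff pS by (simp add: algebra_simps)
      then show "\<bar>push (supp \<mu>) t (\<lambda>x. \<mu> x - emp_est \<mu> xs x) y\<bar>
        = mass \<mu> * \<bar>measure ?P S - real (length (filter (\<lambda>x. x \<in> S) xs)) / real n\<bar>"
        using \<mu>(3) by (simp add: abs_mult)
    qed
  qed auto
  also have "\<dots> \<le> mass \<mu> * sqrt (measure ?P S / real n)"
    using \<mu>(3) expectation_sample_frequency[OF fin \<open>0 < n\<close>, of S] by simp
  also have "\<dots> = sqrt (mass \<mu>) * sqrt (mass \<mu> * measure ?P S) / sqrt (real n)"
    using \<mu>(3) by (simp add: real_sqrt_mult real_sqrt_divide)
  finally show ?thesis
    unfolding pS .
qed

lemma emp_est_nonneg: "0 \<le> mass \<mu> \<Longrightarrow> 0 \<le> emp_est \<mu> xs x"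
  by (simp add: emp_est_def)

lemma emp_est_outside: "set xs \<subseteq> Z \<Longrightarrow> x \<notin> Z \<Longrightarrow> emp_est \<mu> xs x = 0"
  by (auto simp: emp_est_def count_list_0_iff)

lemma sum_emp_est:
  assumes "finite Z" "set xs \<subseteq> Z" "xs \<noteq> []"
  shows "(\<Sum>x\<in>Z. emp_est \<mu> xs x) = mass \<mu>"
  using sum_count_list_if[OF assms(1,2), of "\<lambda>_. True"] assms(3)
  by (simp add: emp_est_def flip: sum_distrib_left sum_divide_distrib)

text \<open>Only cells indexed by \<open>Q\<close> can be nonzero, and their masses add up to
  \<open>mass \<mu>\<close>; Cauchy-Schwarz against the constant one bounds the sum of their roots
  and brings in the root of \<open>card Q\<close>.\<close>

lemma expectation_l1_push:
  fixes \<mu> :: "'a \<Rightarrow> real"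
  assumes \<mu>: "\<And>x. 0 \<le> \<mu> x" "finite (supp \<mu>)" "0 < mass \<mu>" and "0 < n"
    and t: "t \<in> supp \<mu> \<rightarrow> Q" and Q: "Q \<subseteq> supp \<mu>"
  shows "measure_pmf.expectation (replicate_pmf n (normalised_pmf \<mu>))
      (\<lambda>xs. \<Sum>y\<in>supp \<mu>. \<bar>push (supp \<mu>) t (\<lambda>x. \<mu> x - emp_est \<mu> xs x) y\<bar>)
    \<le> mass \<mu> * sqrt (real (card Q)) / sqrt (real n)"
proof -
  let ?Z = "supp \<mu>"
  have fin: "finite (set_pmf (replicate_pmf n (normalised_pmf \<mu>)))"
    using \<mu> by (intro finite_set_replicate_pmf) (simp add: set_normalised_pmf)
  have finQ: "finite Q"
    using Q \<mu>(2) by (rule finite_subset)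
  have tZ: "t \<in> ?Z \<rightarrow> ?Z"
    using t Q by auto
  have "measure_pmf.expectation (replicate_pmf n (normalised_pmf \<mu>))
      (\<lambda>xs. \<Sum>y\<in>?Z. \<bar>push ?Z t (\<lambda>x. \<mu> x - emp_est \<mu> xs x) y\<bar>)
    = (\<Sum>y\<in>?Z. measure_pmf.expectation (replicate_pmf n (normalised_pmf \<mu>))
      (\<lambda>xs. \<bar>push ?Z t (\<lambda>x. \<mu> x - emp_est \<mu> xs x) y\<bar>))"
    by (intro Bochner_Integration.integral_sum integrable_measure_pmf_finite fin)
  also have "\<dots> \<le> (\<Sum>y\<in>?Z. sqrt (mass \<mu>) * sqrt (push ?Z t \<mu> y) / sqrt (real n))"
    by (intro sum_mono expectation_abs_push \<mu> \<open>0 < n\<close>)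
  also have "\<dots> = (\<Sum>y\<in>Q. sqrt (mass \<mu>) * sqrt (push ?Z t \<mu> y) / sqrt (real n))"
    using \<mu>(2) Q push_outside[OF t, of _ \<mu>] by (intro sum.mono_neutral_right) auto
  also have "\<dots> = sqrt (mass \<mu>) / sqrt (real n) * (\<Sum>y\<in>Q. sqrt (push ?Z t \<mu> y))"
    by (simp add: sum_distrib_left)
  also have "\<dots> \<le> sqrt (mass \<mu>) / sqrt (real n) * (sqrt (real (card Q)) * sqrt (mass \<mu>))"
  proof (intro mult_left_mono)
    have "(\<Sum>y\<in>Q. sqrt (push ?Z t \<mu> y)) \<le> sqrt (real (card Q)) * sqrt (\<Sum>y\<in>Q. push ?Z t \<mu> y)"
      using L2_set_mult_ineq[of "\<lambda>_. 1" "\<lambda>y. sqrt (push ?Z t \<mu> y)" Q] push_nonneg[of \<mu>, OF \<mu>(1)]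
      by (simp add: L2_set_def)
    also have "(\<Sum>y\<in>Q. push ?Z t \<mu> y) = (\<Sum>y\<in>?Z. push ?Z t \<mu> y)"
      using \<mu>(2) Q push_outside[OF t, of _ \<mu>] by (intro sum.mono_neutral_left) auto
    also have "\<dots> = mass \<mu>"
      using sum_push[OF \<mu>(2) tZ, of \<mu>] by (simp add: mass_def)
    finally show "(\<Sum>y\<in>Q. sqrt (push ?Z t \<mu> y)) \<le> sqrt (real (card Q)) * sqrt (mass \<mu>)" .
  qed (use \<mu> in auto)
  also have "\<dots> = mass \<mu> * sqrt (real (card Q)) / sqrt (real n)"
    using \<mu>(3) by simp
  finally show ?thesis .
qed

section \<open>Covering trees and the expected deviation\<close>

text \<open>The least cardinality is attained, since \<open>Z\<close> covers itself at any radius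
  \<open>r \<ge> 0\<close>.\<close>

lemma cover_num_cover:
  assumes "finite Z" "0 \<le> r"
  obtains S where "S \<subseteq> Z" "card S = cover_num Z r" "\<And>z. z \<in> Z \<Longrightarrow> \<exists>s\<in>S. dist z s \<le> r"
proof -
  have "\<exists>S\<subseteq>Z. card S = cover_num Z r \<and> (\<forall>z\<in>Z. \<exists>s\<in>S. dist z s \<le> r)"
    unfolding cover_num_def
    by (rule LeastI[of _ "card Z"]) (use assms in \<open>auto intro!: exI[of _ Z] bexI\<close>)
  then show ?thesis
    using that by blast
qed

text \<open>Any single point of \<open>Z\<close> is a cover at this radius, so the tree has one
  root.\<close>

lemma cover_num_diameter_le:
  assumes "finite Z" "Z \<noteq> {}"
  shows "cover_num Z (diameter Z) \<le> 1"
proof -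
  obtain z where "z \<in> Z"
    using assms by blast
  then show ?thesis
    unfolding cover_num_def using assms diameter_bounded_bound[of Z _ z]
    by (intro Least_le exI[of _ "{z}"]) (auto simp: finite_imp_bounded)
qed

text \<open>\<open>ancestor par L k\<close> maps a point, viewed as a leaf at level \<open>Suc L\<close>, to its ancestor at level
  \<open>Suc L - k\<close>.\<close>

primrec ancestor :: "(nat \<Rightarrow> 'a \<Rightarrow> 'a) \<Rightarrow> nat \<Rightarrow> nat \<Rightarrow> 'a \<Rightarrow> 'a" where
  "ancestor par L 0 = id"
| "ancestor par L (Suc k) = par (L - k) \<circ> ancestor par L k"

text \<open>Ancestors are compositions of parent maps rather than separate projections onto the
  covers, so the levels are compatible by construction. The points themselves form an extra level
  \<open>Suc L\<close> below the finest cover.\<close>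

lemma level_tree:
  fixes Z :: "'a::metric_space set"
  assumes Z: "finite Z" and q: "0 < q"
  obtains Q a par where
    "\<And>j. Q j \<subseteq> Z" "\<And>j. j \<le> L \<Longrightarrow> card (Q j) = cover_num Z (q powr (- real j) * diameter Z)"
    "Q (Suc L) = Z"
    "\<And>j. j \<le> Suc L \<Longrightarrow> a j \<in> Z \<rightarrow> Q j" "\<And>j. a j \<in> Z \<rightarrow> Z" "\<And>j. par j \<in> Z \<rightarrow> Z"
    "\<And>j x. j < Suc L \<Longrightarrow> a j x = par j (a (Suc j) x)" "\<And>x. a (Suc L) x = x"
    "\<And>j x. x \<in> Z \<Longrightarrow> dist x (par j x) \<le> q powr (- real j) * diameter Z"
proof -
  have r: "0 \<le> q powr (- real j) * diameter Z" for j
    using q Z by (simp add: diameter_ge_0 finite_imp_bounded)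
  have "\<exists>S par. S \<subseteq> Z \<and> card S = cover_num Z (q powr (- real j) * diameter Z) \<and>
      par \<in> Z \<rightarrow> S \<and> (\<forall>x\<in>Z. dist x (par x) \<le> q powr (- real j) * diameter Z)" for j :: nat
  proof -
    obtain S where S: "S \<subseteq> Z" "card S = cover_num Z (q powr (- real j) * diameter Z)"
      "\<And>z. z \<in> Z \<Longrightarrow> \<exists>s\<in>S. dist z s \<le> q powr (- real j) * diameter Z"
      using cover_num_cover[OF Z r] by blast
    then obtain par where "\<And>z. z \<in> Z \<Longrightarrow> par z \<in> S \<and> dist z (par z) \<le> q powr (- real j) * diameter Z"
      by metis
    with S show ?thesis
      by blast
  qed
  then obtain S par where S: "\<And>j. S j \<subseteq> Z"
    "\<And>j. card (S j) = cover_num Z (q powr (- real j) * diameter Z)"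
    and par: "\<And>j. par j \<in> Z \<rightarrow> S j"
    "\<And>j x. x \<in> Z \<Longrightarrow> dist x (par j x) \<le> q powr (- real j) * diameter Z"
    by metis
  have parZ: "par j \<in> Z \<rightarrow> Z" for j
    using S(1) par(1) by blast
  define a where "a = (\<lambda>j. ancestor par L (Suc L - j))"
  define Q where "Q = (\<lambda>j. if j = Suc L then Z else S j)"
  have anc: "ancestor par L k \<in> Z \<rightarrow> Z" for k
    using parZ by (induction k) (auto simp: Pi_iff)
  have step: "a j x = par j (a (Suc j) x)" if "j < Suc L" for j x
    using that by (simp add: a_def Suc_diff_le)
  have aQ: "a j \<in> Z \<rightarrow> Q j" if "j \<le> Suc L" for j
  proof (cases "j = Suc L")
    case False
    with that have "j < Suc L"
      by simp
    with step[OF this] par(1)[of j] anc show ?thesis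
      by (auto simp: Q_def Pi_iff a_def)
  qed (simp add: a_def Q_def)
  show ?thesis
    by (rule that[of Q a par]) (use S par parZ anc step aQ in \<open>auto simp: Q_def a_def\<close>)
qed

text \<open>\<open>hq Z q L k\<close> is the geometric sum of the edge lengths
  \<open>q powr (- real j) * diameter Z\<close> for \<open>j\<close> from \<open>k\<close> to
  \<open>L\<close>, the height of level \<open>k\<close> above the leaves. Dropping the subtracted
  term gives the weight of level \<open>l\<close> in \<open>Aq\<close>.\<close>

lemma hq_le:
  assumes "1 < q" "finite Z" "1 \<le> l"
  shows "hq Z q L (l - 1) \<le> diameter Z * (q / (q - 1) * q powr (1 - real l))"
proof -
  have "q powr (1 - real (l - 1)) = q * q powr (1 - real l)"
    using assms powr_mult_base[of q "1 - real l"] by (simp add: of_nat_diff)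
  then have "(q powr (1 - real (l - 1)) - q powr (- real L)) / (q - 1) \<le> q * q powr (1 - real l) / (q - 1)"
    using assms by (intro divide_right_mono) auto
  moreover have "0 \<le> diameter Z"
    using assms by (simp add: diameter_ge_0 finite_imp_bounded)
  ultimately have "hq Z q L (l - 1) \<le> q * q powr (1 - real l) / (q - 1) * diameter Z"
    unfolding hq_def by (rule mult_right_mono)
  then show ?thesis
    by (simp add: mult_ac)
qed

text \<open>The edges between levels \<open>j\<close> and \<open>Suc j\<close> have length factor
  \<open>q powr (1 - real (Suc j))\<close>, which shifts the index by one; the edges above the
  leaves, \<open>j = L\<close>, give the separate term with \<open>card Z\<close>. The factor
  \<open>q / (q - 1)\<close> is at least one.\<close>

lemma level_sum_le:
  fixes Z :: "'a::metric_space set"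
  assumes q: "1 < q" and Z: "finite Z" and "l \<le> L"
    and Q: "\<And>j. j \<le> L \<Longrightarrow> card (Q j) = cover_num Z (q powr (- real j) * diameter Z)"
    "Q (Suc L) = Z"
  shows "(\<Sum>j\<in>{l..<Suc L}. q powr (- real j) * diameter Z * sqrt (real (card (Q (Suc j))))) \<le> Aq Z q L (Suc l)"
proof -
  let ?w = "\<lambda>j. q powr (1 - real j) * sqrt (real (cover_num Z (q powr (- real j) * diameter Z)))"
  have d: "0 \<le> diameter Z"
    using Z by (simp add: diameter_ge_0 finite_imp_bounded)
  have "(\<Sum>j\<in>{l..<L}. q powr (- real j) * diameter Z * sqrt (real (card (Q (Suc j)))))
      = diameter Z * (\<Sum>j\<in>{l..<L}. ?w (Suc j))"
    unfolding sum_distrib_left using Q(1) by (intro sum.cong) auto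
  also have "(\<Sum>j\<in>{l..<L}. ?w (Suc j)) = (\<Sum>j\<in>{Suc l..L}. ?w j)"
    by (subst sum.shift_bounds_Suc_ivl[symmetric]) (simp only: atLeastLessThanSuc_atLeastAtMost)
  also have "diameter Z * (\<Sum>j\<in>{Suc l..L}. ?w j) \<le> diameter Z * (q / (q - 1) * (\<Sum>j\<in>{Suc l..L}. ?w j))"
  proof (intro mult_left_mono d)
    have "1 * (\<Sum>j\<in>{Suc l..L}. ?w j) \<le> q / (q - 1) * (\<Sum>j\<in>{Suc l..L}. ?w j)"
      using q by (intro mult_right_mono sum_nonneg) auto
    then show "(\<Sum>j\<in>{Suc l..L}. ?w j) \<le> q / (q - 1) * (\<Sum>j\<in>{Suc l..L}. ?w j)"
      by simp
  qed
  finally have "(\<Sum>j\<in>{l..<L}. q powr (- real j) * diameter Z * sqrt (real (card (Q (Suc j)))))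
      \<le> diameter Z * (q / (q - 1) * (\<Sum>j\<in>{Suc l..L}. ?w j))" .
  moreover have "q powr (- real L) * diameter Z * sqrt (real (card (Q (Suc L))))
      = diameter Z * (q powr (- real L) * sqrt (real (card Z)))"
    using Q(2) by simp
  ultimately show ?thesis
    unfolding Aq_def distrib_left sum.atLeastLessThan_Suc[OF \<open>l \<le> L\<close>] by linarith
qed

text \<open>\<open>T\<close> is chosen before \<open>G\<close> and depends on the sample alone, so
  \<open>G\<close> may itself vary with the sample; this matters for the empirical minimiser. In
  \<open>cut\<close>, either the stopping cost sits at the root and has expectation zero, or it is
  absorbed by the summand of \<open>Aq\<close> at level \<open>l\<close>.\<close>

lemma expected_tree_bound:
  fixes \<mu> :: "'a::metric_space \<Rightarrow> real"
  assumes \<mu>: "\<And>x. 0 \<le> \<mu> x" "finite (supp \<mu>)" "0 < mass \<mu>" and "0 < n"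
    and q: "1 < q" and C: "0 \<le> C" and "l \<le> L"
    and cut: "l = 0 \<and> A = Aq (supp \<mu>) q L 1 \<or>
      1 \<le> l \<and> C \<le> 2 * hq (supp \<mu>) q L (l - 1) \<and> A = Aq (supp \<mu>) q L l"
  shows "\<exists>T. (\<forall>G K xs. coupling_lipschitz (supp \<mu>) C K G \<longrightarrow> 0 \<le> K \<longrightarrow>
        xs \<in> set_pmf (replicate_pmf n (normalised_pmf \<mu>)) \<longrightarrow> \<bar>G \<mu> - G (emp_est \<mu> xs)\<bar> \<le> K * T xs)
    \<and> measure_pmf.expectation (replicate_pmf n (normalised_pmf \<mu>)) T \<le> mass \<mu> * A / sqrt (real n)"
proof -
  let ?Z = "supp \<mu>" and ?R = "replicate_pmf n (normalised_pmf \<mu>)"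
  have "0 < q"
    using q by simp
  obtain Q a par where Q: "\<And>j. Q j \<subseteq> ?Z"
      "\<And>j. j \<le> L \<Longrightarrow> card (Q j) = cover_num ?Z (q powr (- real j) * diameter ?Z)" "Q (Suc L) = ?Z"
    and a: "\<And>j. j \<le> Suc L \<Longrightarrow> a j \<in> ?Z \<rightarrow> Q j" "\<And>j. a j \<in> ?Z \<rightarrow> ?Z"
    and par: "\<And>j. par j \<in> ?Z \<rightarrow> ?Z"
    and apar: "\<And>j x. j < Suc L \<Longrightarrow> a j x = par j (a (Suc j) x)" and an: "\<And>x. a (Suc L) x = x"
    and dist: "\<And>j x. x \<in> ?Z \<Longrightarrow> dist x (par j x) \<le> q powr (- real j) * diameter ?Z"
    by (rule level_tree[OF \<mu>(2) \<open>0 < q\<close>, where L = L]) (rule that)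
  define r where "r = (\<lambda>j::nat. q powr (- real j) * diameter ?Z)"
  define S where "S = (\<lambda>j xs. \<Sum>y\<in>?Z. \<bar>push ?Z (a j) (\<lambda>x. \<mu> x - emp_est \<mu> xs x) y\<bar>)"
  define T where "T = (\<lambda>xs. (\<Sum>j\<in>{l..<Suc L}. r j * S (Suc j) xs) + C / 2 * S l xs)"
  have d: "0 \<le> diameter ?Z"
    using \<mu> by (simp add: diameter_ge_0 finite_imp_bounded)
  have r: "0 \<le> r j" for j
    using d by (simp add: r_def)
  have ne: "?Z \<noteq> {}"
    using \<mu>(3) by (auto simp: mass_def)
  have xs: "set xs \<subseteq> ?Z" "(\<Sum>x\<in>?Z. \<mu> x) = (\<Sum>x\<in>?Z. emp_est \<mu> xs x)" if "xs \<in> set_pmf ?R" for xs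
  proof -
    show *: "set xs \<subseteq> ?Z"
      using that \<mu> by (auto simp: set_replicate_pmf set_normalised_pmf)
    have "xs \<noteq> []"
      using that \<open>0 < n\<close> by (auto simp: set_replicate_pmf)
    then show "(\<Sum>x\<in>?Z. \<mu> x) = (\<Sum>x\<in>?Z. emp_est \<mu> xs x)"
      using sum_emp_est[OF \<mu>(2) *, of \<mu>] by (simp add: mass_def)
  qed
  have int: "integrable (measure_pmf ?R) f" for f :: "'a list \<Rightarrow> real"
    using \<mu> by (intro integrable_measure_pmf_finite finite_set_replicate_pmf) (simp add: set_normalised_pmf)
  have ES: "measure_pmf.expectation ?R (S j) \<le> mass \<mu> * sqrt (real (card (Q j))) / sqrt (real n)"
    if "j \<le> Suc L" for j
    unfolding S_def by (rule expectation_l1_push[OF \<mu> \<open>0 < n\<close> a(1)[OF that] Q(1)])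
  \<comment> \<open>Level \<open>0\<close> has at most one node, which carries the whole mass
    difference, and that is zero.\<close>
  have E0: "measure_pmf.expectation ?R (S 0) = 0"
  proof -
    have "S 0 xs = 0" if "xs \<in> set_pmf ?R" for xs
    proof -
      let ?f = "push ?Z (a 0) (\<lambda>x. \<mu> x - emp_est \<mu> xs x)"
      have "(\<Sum>y\<in>?Z. ?f y) = 0"
        using sum_push[OF \<mu>(2) a(2)] xs[OF that] by (simp add: sum_subtractf)
      also have "(\<Sum>y\<in>?Z. ?f y) = (\<Sum>y\<in>Q 0. ?f y)"
        using \<mu>(2) Q(1) push_outside[OF a(1)[of 0]] by (intro sum.mono_neutral_right) auto
      finally have sum0: "(\<Sum>y\<in>Q 0. ?f y) = 0" .
      have "card (Q 0) \<le> 1"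
        using cover_num_diameter_le[OF \<mu>(2) ne] Q(2)[of 0] q by simp
      moreover have "finite (Q 0)"
        using Q(1) \<mu>(2) by (rule finite_subset)
      ultimately have "y \<in> Q 0 \<Longrightarrow> Q 0 = {y}" for y
        using card_le_Suc0_iff_eq[of "Q 0"] by auto
      with sum0 have "?f y = 0" if "y \<in> Q 0" for y
        using that by force
      then have "?f y = 0" for y
        using push_outside[OF a(1)[of 0]] by (cases "y \<in> Q 0") auto
      then show ?thesis
        by (simp add: S_def)
    qed
    then show ?thesis
      by (intro integral_eq_zero_AE) (simp add: AE_measure_pmf_iff)
  qed
  have "measure_pmf.expectation ?R T
      = (\<Sum>j\<in>{l..<Suc L}. r j * measure_pmf.expectation ?R (S (Suc j)))
        + C / 2 * measure_pmf.expectation ?R (S l)"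
    unfolding T_def by (simp add: int del: sum.op_ivl_Suc)
  also have "(\<Sum>j\<in>{l..<Suc L}. r j * measure_pmf.expectation ?R (S (Suc j)))
      \<le> (\<Sum>j\<in>{l..<Suc L}. r j * (mass \<mu> * sqrt (real (card (Q (Suc j)))) / sqrt (real n)))"
    by (intro sum_mono mult_left_mono ES r) auto
  also have "\<dots> = mass \<mu> * (\<Sum>j\<in>{l..<Suc L}. r j * sqrt (real (card (Q (Suc j))))) / sqrt (real n)"
    unfolding sum_distrib_left sum_divide_distrib by (intro sum.cong) auto
  also have "\<dots> \<le> mass \<mu> * Aq ?Z q L (Suc l) / sqrt (real n)"
    unfolding r_def using \<mu> level_sum_le[OF q \<mu>(2) \<open>l \<le> L\<close> Q(2,3)]
    by (intro divide_right_mono mult_left_mono) auto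
  finally have ET: "measure_pmf.expectation ?R T
      \<le> mass \<mu> * Aq ?Z q L (Suc l) / sqrt (real n) + C / 2 * measure_pmf.expectation ?R (S l)"
    by simp
  have "measure_pmf.expectation ?R T \<le> mass \<mu> * A / sqrt (real n)"
    using cut
  proof (elim disjE conjE)
    assume "l = 0" "A = Aq ?Z q L 1"
    then show ?thesis
      using ET E0 by simp
  next
    assume l: "1 \<le> l" "C \<le> 2 * hq ?Z q L (l - 1)" and A: "A = Aq ?Z q L l"
    let ?w = "q powr (1 - real l) * sqrt (real (cover_num ?Z (q powr (- real l) * diameter ?Z)))"
    \<comment> \<open>The stopping cost is charged to the height of the parents at level
      \<open>l - 1\<close>, which is at most the weight of level \<open>l\<close> in
      \<open>Aq\<close>.\<close>
    have C2: "C / 2 \<le> diameter ?Z * (q / (q - 1) * q powr (1 - real l))"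
      using l(2) hq_le[OF q \<mu>(2) l(1), of L] by linarith
    have "C / 2 * measure_pmf.expectation ?R (S l)
        \<le> C / 2 * (mass \<mu> * sqrt (real (card (Q l))) / sqrt (real n))"
      using C \<open>l \<le> L\<close> by (intro mult_left_mono ES) auto
    also have "\<dots> \<le> diameter ?Z * (q / (q - 1) * q powr (1 - real l))
        * (mass \<mu> * sqrt (real (card (Q l))) / sqrt (real n))"
      using C2 \<mu> by (intro mult_right_mono) auto
    also have "\<dots> = mass \<mu> * (diameter ?Z * (q / (q - 1) * ?w)) / sqrt (real n)"
      using Q(2)[OF \<open>l \<le> L\<close>] by simp
    finally have "measure_pmf.expectation ?R T \<le> mass \<mu> * Aq ?Z q L (Suc l) / sqrt (real n)
        + mass \<mu> * (diameter ?Z * (q / (q - 1) * ?w)) / sqrt (real n)"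
      using ET by linarith
    \<comment> \<open>The sum in \<open>Aq\<close> at \<open>Suc l\<close> lacks exactly the summand
      \<open>j = l\<close> that the stopping cost has just provided.\<close>
    also have "\<dots> = mass \<mu> * A / sqrt (real n)"
      unfolding A Aq_def sum.atLeast_Suc_atMost[OF \<open>l \<le> L\<close>]
      by (simp add: distrib_left add_divide_distrib)
    finally show ?thesis .
  qed
  moreover have "\<bar>G \<mu> - G (emp_est \<mu> ys)\<bar> \<le> K * T ys"
    if "coupling_lipschitz ?Z C K G" "0 \<le> K" and ys: "ys \<in> set_pmf ?R" for G K ys
    unfolding T_def S_def
  proof (rule tree_bound[where n = "Suc L" and par = par, OF that(1) \<mu>(2) C that(2) a(2) par])
    show "emp_est \<mu> ys x = 0" if "x \<notin> ?Z" for x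
      by (rule emp_est_outside[OF xs(1)[OF ys] that])
    show "0 \<le> emp_est \<mu> ys x" for x
      using \<mu>(3) by (simp add: emp_est_nonneg)
  qed (use \<mu> apar an dist \<open>l \<le> L\<close> xs(2)[OF ys] in \<open>auto simp: r_def supp_def\<close>)
  ultimately show ?thesis
    by blast
qed

text \<open>This is the tree cut at its leaves: nothing climbs, and each unit of difference pays
  \<open>C / 2\<close>. The cells are single points, and the sum of the roots of their masses is
  kept as it is.\<close>

lemma expected_total_variation_bound:
  fixes \<mu> :: "'a::metric_space \<Rightarrow> real"
  assumes \<mu>: "\<And>x. 0 \<le> \<mu> x" "finite (supp \<mu>)" "0 < mass \<mu>" and "0 < n" and C: "0 \<le> C"
  shows "\<exists>T. (\<forall>G K xs. coupling_lipschitz (supp \<mu>) C K G \<longrightarrow> 0 \<le> K \<longrightarrow>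
        xs \<in> set_pmf (replicate_pmf n (normalised_pmf \<mu>)) \<longrightarrow> \<bar>G \<mu> - G (emp_est \<mu> xs)\<bar> \<le> K * T xs)
    \<and> measure_pmf.expectation (replicate_pmf n (normalised_pmf \<mu>)) T
      \<le> C / 2 * sqrt (mass \<mu>) * (\<Sum>x\<in>supp \<mu>. sqrt (\<mu> x)) / sqrt (real n)"
proof -
  let ?Z = "supp \<mu>" and ?R = "replicate_pmf n (normalised_pmf \<mu>)"
  define T where "T = (\<lambda>xs. C / 2 * (\<Sum>y\<in>?Z. \<bar>push ?Z (\<lambda>x. x) (\<lambda>x. \<mu> x - emp_est \<mu> xs x) y\<bar>))"
  have int: "integrable (measure_pmf ?R) f" for f :: "'a list \<Rightarrow> real"
    using \<mu> by (intro integrable_measure_pmf_finite finite_set_replicate_pmf) (simp add: set_normalised_pmf)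
  have push_id: "push ?Z (\<lambda>x. x) \<mu> y = \<mu> y" for y
    using \<mu>(2) by (simp add: push_def supp_def)
  have "measure_pmf.expectation ?R T
    = C / 2 * (\<Sum>y\<in>?Z. measure_pmf.expectation ?R (\<lambda>xs. \<bar>push ?Z (\<lambda>x. x) (\<lambda>x. \<mu> x - emp_est \<mu> xs x) y\<bar>))"
    unfolding T_def by (simp add: int)
  also have "\<dots> \<le> C / 2 * (\<Sum>y\<in>?Z. sqrt (mass \<mu>) * sqrt (push ?Z (\<lambda>x. x) \<mu> y) / sqrt (real n))"
    using C by (intro mult_left_mono sum_mono expectation_abs_push \<mu> \<open>0 < n\<close>) auto
  also have "\<dots> = C / 2 * sqrt (mass \<mu>) * (\<Sum>x\<in>?Z. sqrt (\<mu> x)) / sqrt (real n)"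
    unfolding push_id by (simp flip: sum_distrib_left sum_divide_distrib)
  finally have ET: "measure_pmf.expectation ?R T \<le> \<dots>" .
  have "\<bar>G \<mu> - G (emp_est \<mu> xs)\<bar> \<le> K * T xs"
    if G: "coupling_lipschitz ?Z C K G" "0 \<le> K" and xs: "xs \<in> set_pmf ?R" for G K xs
  proof -
    have sub: "set xs \<subseteq> ?Z" "xs \<noteq> []"
      using xs \<mu> \<open>0 < n\<close> by (auto simp: set_replicate_pmf set_normalised_pmf)
    \<comment> \<open>A tree with the single level \<open>0\<close>, so the sum over edges is
      empty.\<close>
    have "\<bar>G \<mu> - G (emp_est \<mu> xs)\<bar> \<le> K * ((\<Sum>j\<in>{0..<0::nat}. 0 * (\<Sum>y\<in>?Z. \<bar>push ?Z (\<lambda>x. x) (\<lambda>x. \<mu> x - emp_est \<mu> xs x) y\<bar>))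
        + C / 2 * (\<Sum>y\<in>?Z. \<bar>push ?Z (\<lambda>x. x) (\<lambda>x. \<mu> x - emp_est \<mu> xs x) y\<bar>))"
      by (rule tree_bound[where n = 0 and l = 0 and a = "\<lambda>_ x. x" and par = "\<lambda>_ x. x" and r = "\<lambda>_. 0",
            OF G(1) \<mu>(2) C G(2)])
        (use \<mu> sub sum_emp_est[OF \<mu>(2) sub, of \<mu>] in
          \<open>auto simp: emp_est_nonneg emp_est_outside mass_def supp_def\<close>)
    then show ?thesis
      by (simp add: T_def)
  qed
  with ET show ?thesis
    by blast
qed

lemma EMult_qL_bound:
  fixes \<mu> :: "'a::metric_space \<Rightarrow> real"
  assumes \<mu>: "\<And>x. 0 \<le> \<mu> x" "finite (supp \<mu>)" "0 < mass \<mu>" and n: "0 < n"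
    and C: "0 \<le> C" and q: "1 < q" and L: "1 \<le> L"
  shows "\<exists>T. (\<forall>G K xs. coupling_lipschitz (supp \<mu>) C K G \<longrightarrow> 0 \<le> K \<longrightarrow>
        xs \<in> set_pmf (replicate_pmf n (normalised_pmf \<mu>)) \<longrightarrow> \<bar>G \<mu> - G (emp_est \<mu> xs)\<bar> \<le> K * T xs)
    \<and> measure_pmf.expectation (replicate_pmf n (normalised_pmf \<mu>)) T
      \<le> EMult_qL (supp \<mu>) \<mu> C q L / sqrt (real n)"
proof -
  let ?Z = "supp \<mu>"
  consider (tv) "card ?Z \<le> 1 \<or> C \<le> max (2 * hq ?Z q L L) (min_sep ?Z)"
    | (root) "\<not> (card ?Z \<le> 1 \<or> C \<le> max (2 * hq ?Z q L L) (min_sep ?Z))" "2 * hq ?Z q L 0 \<le> C"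
    | (mid) "\<not> (card ?Z \<le> 1 \<or> C \<le> max (2 * hq ?Z q L L) (min_sep ?Z))" "\<not> 2 * hq ?Z q L 0 \<le> C"
    by blast
  then show ?thesis
  proof cases
    case tv
    then show ?thesis
      unfolding EMult_qL_def using expected_total_variation_bound[OF \<mu> n C] by simp
  next
    case root
    then show ?thesis
      unfolding EMult_qL_def using expected_tree_bound[where l = 0 and L = L, OF \<mu> n q C _ disjI1] by simp
  next
    case mid
    \<comment> \<open>The least level of height at most \<open>C / 2\<close> only shows that the
      choice in \<open>EMult_qL\<close> has a witness: level \<open>L\<close> qualifies by the
      failed first test, level \<open>0\<close> does not. The bound then works for whichever level
      \<open>SOME\<close> selects.\<close>
    define l where "l = (LEAST l. 2 * hq ?Z q L l \<le> C)"
    have le: "2 * hq ?Z q L L \<le> C"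
      using mid(1) by (simp add: not_le)
    have l1: "2 * hq ?Z q L l \<le> C"
      unfolding l_def by (rule LeastI[of _ L]) (rule le)
    have "l \<le> L"
      unfolding l_def by (rule Least_le) (rule le)
    moreover have "l \<noteq> 0"
      using l1 mid(2) by metis
    moreover have "\<not> 2 * hq ?Z q L (l - 1) \<le> C"
      using not_less_Least[of "l - 1" "\<lambda>l. 2 * hq ?Z q L l \<le> C"] \<open>l \<noteq> 0\<close> by (simp flip: l_def)
    ultimately have "l \<in> {1..L} \<and> 2 * hq ?Z q L l \<le> C \<and> C < 2 * hq ?Z q L (l - 1)"
      using l1 by auto
    then have "(SOME l. l \<in> {1..L} \<and> 2 * hq ?Z q L l \<le> C \<and> C < 2 * hq ?Z q L (l - 1)) \<in> {1..L} \<and>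
      C < 2 * hq ?Z q L ((SOME l. l \<in> {1..L} \<and> 2 * hq ?Z q L l \<le> C \<and> C < 2 * hq ?Z q L (l - 1)) - 1)"
      (is "?l \<in> _ \<and> _")
      by (rule someI2) blast
    then have "?l \<le> L" "1 \<le> ?l \<and> C \<le> 2 * hq ?Z q L (?l - 1) \<and> Aq ?Z q L ?l = Aq ?Z q L ?l"
      by auto
    from expected_tree_bound[OF \<mu> n q C this(1) disjI2, OF this(2)] show ?thesis
      unfolding EMult_qL_def if_not_P[OF mid(1)] if_not_P[OF mid(2)] .
  qed
qed

section \<open>Excess risk of the empirical minimiser\<close>

lemma finite_set_sample_pmf:
  assumes "\<And>i. i < J \<Longrightarrow> finite (set_pmf (normalised_pmf (\<mu>s i)))"
  shows "finite (set_pmf (sample_pmf J \<mu>s N))"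
  unfolding sample_pmf_def
  using assms by (subst set_Pi_pmf) (auto intro!: finite_PiE_dflt finite_set_replicate_pmf)

theorem theoremA3:
  fixes Y X :: "'a::metric_space set"
    and J :: nat and \<mu>s :: "nat \<Rightarrow> 'a \<Rightarrow> real" and N :: "nat \<Rightarrow> nat"
    and p C :: real
    and \<mu>star :: "'a \<Rightarrow> real" and \<mu>hat_star :: "(nat \<Rightarrow> 'a list) \<Rightarrow> 'a \<Rightarrow> real"
  assumes "connected Y" and "X \<subseteq> Y" and "finite X" and "J > 0"
    and "\<And>i. i < J \<Longrightarrow> fsmeas X (\<mu>s i)"
    and "\<And>i. i < J \<Longrightarrow> mass (\<mu>s i) > 0"
    and "\<And>i. i < J \<Longrightarrow> N i > 0"
    and "p \<ge> 1" and "C > 0"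
    and "is_minimiser Y (Fbar p C J \<mu>s) \<mu>star"
    and "\<And>\<omega>. \<omega> \<in> set_pmf (sample_pmf J \<mu>s N) \<Longrightarrow>
           is_minimiser Y (Fbar p C J (\<lambda>i. emp_est (\<mu>s i) (\<omega> i))) (\<mu>hat_star \<omega>)"
  shows "measure_pmf.expectation (sample_pmf J \<mu>s N)
           (\<lambda>\<omega>. \<bar>Fbar p C J \<mu>s \<mu>star - Fbar p C J \<mu>s (\<mu>hat_star \<omega>)\<bar>)
         \<le> 2 * p * (if p = 1 then 1 else min_diam Y C powr (p - 1)) / real J *
           (\<Sum>i<J. EMult (supp (\<mu>s i)) (\<mu>s i) C * real (N i) powr (- 1 / 2))"
proof -
  let ?P = "sample_pmf J \<mu>s N"
  define K where "K = lip_const Y p C"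
  define D where "D = (\<lambda>i \<omega> \<nu>. \<bar>KR_pow p C (\<mu>s i) \<nu> - KR_pow p C (emp_est (\<mu>s i) (\<omega> i)) \<nu>\<bar>)"
  have K: "0 \<le> K"
    unfolding K_def using \<open>p \<ge> 1\<close> by (rule lip_const_nonneg)
  have \<mu>: "\<And>x. 0 \<le> \<mu>s i x" "finite (supp (\<mu>s i))" "0 < mass (\<mu>s i)" "supp (\<mu>s i) \<subseteq> Y"
    if "i < J" for i
    using assms that by (auto simp: fsmeas_def)
  have fin: "finite (set_pmf ?P)"
    by (rule finite_set_sample_pmf) (simp add: set_normalised_pmf \<mu>)
  have int: "integrable (measure_pmf ?P) f" for f :: "(nat \<Rightarrow> 'a list) \<Rightarrow> real"
    by (intro integrable_measure_pmf_finite fin)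
  have comp: "map_pmf (\<lambda>\<omega>. \<omega> i) ?P = replicate_pmf (N i) (normalised_pmf (\<mu>s i))" if "i < J" for i
    unfolding sample_pmf_def using that by (simp add: Pi_pmf_component)
  have meas: "fsmeas Y \<mu>star" "\<And>\<omega>. \<omega> \<in> set_pmf ?P \<Longrightarrow> fsmeas Y (\<mu>hat_star \<omega>)"
    using assms by (auto simp: is_minimiser_def)
  have ED: "measure_pmf.expectation ?P (\<lambda>\<omega>. D i \<omega> (\<mu>hat_star \<omega>) + D i \<omega> \<mu>star)
      \<le> 2 * K * (EMult (supp (\<mu>s i)) (\<mu>s i) C / sqrt (real (N i)))" if i: "i < J" for i
  proof -
    let ?Z = "supp (\<mu>s i)"
    let ?E = "measure_pmf.expectation ?P (\<lambda>\<omega>. D i \<omega> (\<mu>hat_star \<omega>) + D i \<omega> \<mu>star)"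
    have bound: "?E \<le> 2 * K * (EMult_qL ?Z (\<mu>s i) C q L / sqrt (real (N i)))" if qL: "1 < q" "1 \<le> L" for q L
    proof -
      obtain T where T: "\<And>G K xs. coupling_lipschitz ?Z C K G \<Longrightarrow> 0 \<le> K \<Longrightarrow>
          xs \<in> set_pmf (replicate_pmf (N i) (normalised_pmf (\<mu>s i))) \<Longrightarrow>
          \<bar>G (\<mu>s i) - G (emp_est (\<mu>s i) xs)\<bar> \<le> K * T xs"
        and ET: "measure_pmf.expectation (replicate_pmf (N i) (normalised_pmf (\<mu>s i))) T
          \<le> EMult_qL ?Z (\<mu>s i) C q L / sqrt (real (N i))"
        using EMult_qL_bound[OF \<mu>(1-3)[OF i] assms(7)[OF i] less_imp_le[OF \<open>C > 0\<close>] qL] by blast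
      \<comment> \<open>The same \<open>T (\<omega> i)\<close> bounds the deviation at the fixed
        minimiser and at the sample-dependent one; adding the two gives the factor two.\<close>
      have DT: "D i \<omega> \<nu> \<le> K * T (\<omega> i)" if "\<omega> \<in> set_pmf ?P" "fsmeas Y \<nu>" for \<omega> \<nu>
        unfolding D_def
      proof (rule T[OF _ K])
        show "coupling_lipschitz ?Z C K (\<lambda>\<mu>. KR_pow p C \<mu> \<nu>)"
          unfolding K_def using assms that \<mu>[OF i] by (intro KR_pow_coupling_lipschitz) auto
        show "\<omega> i \<in> set_pmf (replicate_pmf (N i) (normalised_pmf (\<mu>s i)))"
          unfolding comp[OF i, symmetric] using that by simp
      qed
      have "?E \<le> measure_pmf.expectation ?P (\<lambda>\<omega>. 2 * K * T (\<omega> i))"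
      proof (intro integral_mono_AE int)
        show "AE \<omega> in ?P. D i \<omega> (\<mu>hat_star \<omega>) + D i \<omega> \<mu>star \<le> 2 * K * T (\<omega> i)"
          unfolding AE_measure_pmf_iff
        proof
          fix \<omega> assume \<omega>: "\<omega> \<in> set_pmf ?P"
          show "D i \<omega> (\<mu>hat_star \<omega>) + D i \<omega> \<mu>star \<le> 2 * K * T (\<omega> i)"
            using DT[OF \<omega> meas(1)] DT[OF \<omega> meas(2)[OF \<omega>]] by linarith
        qed
      qed
      also have "\<dots> = 2 * K * measure_pmf.expectation (map_pmf (\<lambda>\<omega>. \<omega> i) ?P) T"
        by simp
      also have "\<dots> \<le> 2 * K * (EMult_qL ?Z (\<mu>s i) C q L / sqrt (real (N i)))"
        unfolding comp[OF i] using K by (intro mult_left_mono ET) auto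
      finally show ?thesis .
    qed
    show ?thesis
    \<comment> \<open>To pass to the infimum over \<open>q\<close> and \<open>L\<close>, the bounds
      are divided by a positive constant. If \<open>K = 0\<close>, any single instance already gives
      the claim, both right-hand sides being zero.\<close>
    proof (cases "K = 0")
      case True
      then show ?thesis
        using bound[of 2 1] by simp
    next
      case False
      define c where "c = 2 * K / sqrt (real (N i))"
      have c: "0 < c"
        using False K assms(7)[OF i] by (simp add: c_def)
      have "?E / c \<le> EMult ?Z (\<mu>s i) C"
        unfolding EMult_def
      proof (rule cInf_greatest)
        have "EMult_qL ?Z (\<mu>s i) C 2 1 \<in> {EMult_qL ?Z (\<mu>s i) C q L |q L. 1 < q \<and> 1 \<le> L}"
          by (intro CollectI exI[of _ 2] exI[of _ 1]) simp
        then show "{EMult_qL ?Z (\<mu>s i) C q L |q L. 1 < q \<and> 1 \<le> L} \<noteq> {}"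
          by blast
        fix e assume "e \<in> {EMult_qL ?Z (\<mu>s i) C q L |q L. 1 < q \<and> 1 \<le> L}"
        then obtain q L where "e = EMult_qL ?Z (\<mu>s i) C q L" "1 < q" "1 \<le> L"
          by blast
        with bound[of q L] c show "?E / c \<le> e"
          by (simp add: pos_divide_le_eq) (simp add: c_def mult_ac)
      qed
      then show ?thesis
        using c by (simp add: pos_divide_le_eq) (simp add: c_def mult_ac)
    qed
  qed
  have gap: "\<bar>Fbar p C J \<mu>s \<mu>star - Fbar p C J \<mu>s (\<mu>hat_star \<omega>)\<bar>
      \<le> (1 / real J) * (\<Sum>i<J. D i \<omega> (\<mu>hat_star \<omega>) + D i \<omega> \<mu>star)" if \<omega>: "\<omega> \<in> set_pmf ?P" for \<omega>
  proof -
    let ?F = "Fbar p C J \<mu>s" and ?H = "Fbar p C J (\<lambda>i. emp_est (\<mu>s i) (\<omega> i))"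
    have dev: "\<bar>?F \<nu> - ?H \<nu>\<bar> \<le> (1 / real J) * (\<Sum>i<J. D i \<omega> \<nu>)" for \<nu>
    proof -
      have "?F \<nu> - ?H \<nu> = (1 / real J) * (\<Sum>i<J. KR_pow p C (\<mu>s i) \<nu> - KR_pow p C (emp_est (\<mu>s i) (\<omega> i)) \<nu>)"
        by (simp add: Fbar_def sum_subtractf right_diff_distrib diff_divide_distrib)
      then show ?thesis
        unfolding D_def by (simp add: abs_mult sum_abs divide_right_mono)
    qed
    \<comment> \<open>The first inequality fixes the sign inside the absolute value. By the second,
      passing from \<open>?F\<close> to \<open>?H\<close> at both minimisers leaves a nonpositive
      difference, so only the two deviations remain.\<close>
    have "?F \<mu>star \<le> ?F (\<mu>hat_star \<omega>)" "?H (\<mu>hat_star \<omega>) \<le> ?H \<mu>star"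
      using assms(10) assms(11)[OF \<omega>] by (auto simp: is_minimiser_def)
    then have "\<bar>?F \<mu>star - ?F (\<mu>hat_star \<omega>)\<bar>
        \<le> (1 / real J) * (\<Sum>i<J. D i \<omega> (\<mu>hat_star \<omega>)) + (1 / real J) * (\<Sum>i<J. D i \<omega> \<mu>star)"
      using dev[of \<mu>star] dev[of "\<mu>hat_star \<omega>"] by linarith
    then show ?thesis
      by (simp add: sum.distrib distrib_left add_divide_distrib)
  qed
  have "measure_pmf.expectation ?P (\<lambda>\<omega>. \<bar>Fbar p C J \<mu>s \<mu>star - Fbar p C J \<mu>s (\<mu>hat_star \<omega>)\<bar>)
      \<le> measure_pmf.expectation ?P (\<lambda>\<omega>. (1 / real J) * (\<Sum>i<J. D i \<omega> (\<mu>hat_star \<omega>) + D i \<omega> \<mu>star))"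
    using gap by (intro integral_mono_AE int) (simp add: AE_measure_pmf_iff)
  also have "\<dots> = (1 / real J) *
      (\<Sum>i<J. measure_pmf.expectation ?P (\<lambda>\<omega>. D i \<omega> (\<mu>hat_star \<omega>) + D i \<omega> \<mu>star))"
    by (subst integral_mult_right_zero, subst Bochner_Integration.integral_sum) (auto intro: int)
  also have "\<dots> \<le> (1 / real J) * (\<Sum>i<J. 2 * K * (EMult (supp (\<mu>s i)) (\<mu>s i) C / sqrt (real (N i))))"
    by (intro mult_left_mono sum_mono ED) auto
  also have "\<dots> = 2 * p * (if p = 1 then 1 else min_diam Y C powr (p - 1)) / real J *
      (\<Sum>i<J. EMult (supp (\<mu>s i)) (\<mu>s i) C * real (N i) powr (- 1 / 2))"
  proof -
    have "real (N i) powr (- 1 / 2) = 1 / sqrt (real (N i))" if "i < J" for i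
      using assms(7)[OF that] by (simp add: powr_minus_divide powr_half_sqrt)
    then show ?thesis
      by (simp add: K_def lip_const_def sum_distrib_left mult.assoc)
  qed
  finally show ?thesis .
qed

end
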